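(* For an integer $d\ge0$ let $m_d=\frac{(d+1)(d+2)}{2}$ denote the number of monomials of degree at most $d$ in two variables. Let $\Delta$ be a pinwheel triangulation (interior cell) in $\mathbb{R}^2$ with $n$ triangles. If the pinwheel has four triangles and a singular vertex, then $$\dim S^1_d(\Delta)=\begin{cases} m_d & \text{if } d\le1,\\ m_d+2m_{d-2} & \text{if } 2\le d\le3,\\ m_d+2m_{d-2}+m_{d-4} & \text{if } d\ge4.\end{cases}$$ If the pinwheel has $n\ge3$ triangles and no singular vertex, then $$\dim S^1_d(\Delta)=\begin{cases} m_d & \text{if } d\le1,\\ m_d+(n-3)m_{d-2} & \text{if } d=2,\\ m_d+(n-3)m_{d-2}+2m_{d-3} & \text{if } d\ge3.\end{cases}$$
   Context: A pinwheel triangulation (interior cell) is a triangulation of a region in $\mathbb{R}^2$ consisting of a single interior vertex and a number of triangles all incident to that vertex and covering a neighborhood of it. $S^1_d(\Delta)$ is the real vector space of functions $F\colon\Delta\to\mathbb{R}$ that are continuously differentiable ($\mathcal{C}^1$) on $\Delta\subseteq\mathbb{R}^2$ and whose restriction to each triangle of $\Delta$ is a polynomial of degree at most $d$. The interior vertex of a pinwheel triangulation is called singular if the edge-labeled dual graph of the triangulation is a $4$-cycle with exactly two distinct edge-labels; equivalently, there are four triangles and the four interior edges lie on two lines through the interior vertex. (The dual graph has one vertex per triangle, an edge for each pair of triangles sharing an edge, and the edge is labeled by the ideal of $\mathbb{R}[x,y]$ generated by a power $\ell^{2}$ of an affine form $\ell$ vanishing on the shared edge.) *)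

theory Defs
  imports "HOL-Analysis.Analysis" "HOL-Library.Function_Algebras"
begin

text \<open>The plane is \<^typ>\<open>real^2\<close>. A triangulated region is given by its set \<open>\<Delta>\<close> of closed triangles;
  the region itself is \<open>\<Union>\<Delta>\<close>. The library's \<^const>\<open>triangulation\<close> requires any two cells
  to meet in a (possibly empty) common face.\<close>

definition interior_vertices :: "(real^2) set set \<Rightarrow> (real^2) set" where
  "interior_vertices \<Delta> = {w. (\<exists>T\<in>\<Delta>. w extreme_point_of T) \<and> w \<in> interior (\<Union>\<Delta>)}"

definition pinwheel_triangulation :: "(real^2) set set \<Rightarrow> bool" where
  "pinwheel_triangulation \<Delta> \<longleftrightarrow>
     triangulation \<Delta> \<and> (\<forall>T\<in>\<Delta>. (2::int) simplex T) \<and>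
     (\<exists>v. interior_vertices \<Delta> = {v} \<and> (\<forall>T\<in>\<Delta>. v extreme_point_of T))"


subsection \<open>The edge-labeled dual graph\<close>

text \<open>An edge of the dual graph is a two-element set \<open>{T, T'}\<close> of triangles;
  the shared edge of the triangulation is then \<open>T \<inter> T' = \<Inter>{T, T'}\<close>.\<close>

definition dual_edges :: "(real^2) set set \<Rightarrow> (real^2) set set set" where
  "dual_edges \<Delta> = {{T, T'} | T T'. T \<in> \<Delta> \<and> T' \<in> \<Delta> \<and> T \<noteq> T' \<and> (1::int) simplex (T \<inter> T')}"

text \<open>Since the real numbers are infinite, the polynomial ring in two variables is represented by
  the ring of polynomial functions on the plane.\<close>

definition principal_ideal :: "(real^2 \<Rightarrow> real) \<Rightarrow> (real^2 \<Rightarrow> real) set" where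
  "principal_ideal f = {\<lambda>p. q p * f p | q. real_polynomial_function q}"

text \<open>The affine forms \<open>p \<mapsto> a \<bullet> p + b\<close> with \<open>a \<noteq> 0\<close> that vanish on a given segment agree up to a
  nonzero scalar, so the ideal described below is unique.\<close>

definition edge_label :: "(real^2) set set \<Rightarrow> (real^2 \<Rightarrow> real) set" where
  "edge_label e = (THE I. \<exists>a b. a \<noteq> 0 \<and> (\<forall>p\<in>\<Inter>e. a \<bullet> p + b = 0) \<and>
                        I = principal_ideal (\<lambda>p. (a \<bullet> p + b)\<^sup>2))"

definition has_singular_vertex :: "(real^2) set set \<Rightarrow> bool" where
  "has_singular_vertex \<Delta> \<longleftrightarrow>
     (\<exists>T1 T2 T3 T4. distinct [T1, T2, T3, T4] \<and> \<Delta> = {T1, T2, T3, T4} \<and>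
        dual_edges \<Delta> = {{T1, T2}, {T2, T3}, {T3, T4}, {T4, T1}}) \<and>
     card (edge_label ` dual_edges \<Delta>) = 2"


subsection \<open>The spline space\<close>

definition polynomial_le :: "nat \<Rightarrow> (real^2 \<Rightarrow> real) \<Rightarrow> bool" where
  "polynomial_le d P \<longleftrightarrow>
     (\<exists>c :: nat \<Rightarrow> nat \<Rightarrow> real.
        \<forall>p. P p = (\<Sum>(i, j)\<in>{(i, j). i + j \<le> d}. c i j * (p $ 1) ^ i * (p $ 2) ^ j))"

text \<open>On a closed region, derivatives are taken within the region, up to and including its
  boundary. At every point of a union of triangles such a derivative is unique.\<close>

definition C1_on :: "(real^2) set \<Rightarrow> (real^2 \<Rightarrow> real) \<Rightarrow> bool" where
  "C1_on S F \<longleftrightarrow>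
     (\<exists>F' :: real^2 \<Rightarrow> ((real^2) \<Rightarrow>\<^sub>L real).
        (\<forall>p\<in>S. (F has_derivative blinfun_apply (F' p)) (at p within S)) \<and> continuous_on S F')"

text \<open>A function on \<open>\<Union>\<Delta>\<close> is represented by its extension by zero to the whole plane,
  so that distinct elements of the space are distinct functions on \<open>\<Union>\<Delta>\<close>.\<close>

definition C1_splines :: "(real^2) set set \<Rightarrow> nat \<Rightarrow> (real^2 \<Rightarrow> real) set" where
  "C1_splines \<Delta> d =
     {F. (\<forall>p. p \<notin> \<Union>\<Delta> \<longrightarrow> F p = 0) \<and> C1_on (\<Union>\<Delta>) F \<and>
         (\<forall>T\<in>\<Delta>. \<exists>P. polynomial_le d P \<and> (\<forall>p\<in>T. F p = P p))}"

definition scale_fun :: "real \<Rightarrow> (real^2 \<Rightarrow> real) \<Rightarrow> real^2 \<Rightarrow> real" where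
  "scale_fun r F = (\<lambda>p. r * F p)"

interpretation fun_vs: vector_space scale_fun
  by unfold_locales (auto simp: scale_fun_def fun_eq_iff algebra_simps)

lemma polynomial_le_0: "polynomial_le d (\<lambda>p. 0)"
  unfolding polynomial_le_def by (rule exI[of _ "\<lambda>i j. 0"]) simp

lemma polynomial_le_add:
  assumes "polynomial_le d P" "polynomial_le d Q"
  shows "polynomial_le d (\<lambda>p. P p + Q p)"
proof -
  obtain c c' where
    "\<And>p. P p = (\<Sum>(i, j)\<in>{(i, j). i + j \<le> d}. c i j * (p $ 1) ^ i * (p $ 2) ^ j)"
    "\<And>p. Q p = (\<Sum>(i, j)\<in>{(i, j). i + j \<le> d}. c' i j * (p $ 1) ^ i * (p $ 2) ^ j)"
    using assms unfolding polynomial_le_def by blast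
  then show ?thesis
    unfolding polynomial_le_def
    by (intro exI[of _ "\<lambda>i j. c i j + c' i j"])
       (simp add: sum.distrib[symmetric] case_prod_unfold algebra_simps)
qed

lemma polynomial_le_scale:
  assumes "polynomial_le d P"
  shows "polynomial_le d (\<lambda>p. r * P p)"
proof -
  obtain c where
    "\<And>p. P p = (\<Sum>(i, j)\<in>{(i, j). i + j \<le> d}. c i j * (p $ 1) ^ i * (p $ 2) ^ j)"
    using assms unfolding polynomial_le_def by blast
  then show ?thesis
    unfolding polynomial_le_def
    by (intro exI[of _ "\<lambda>i j. r * c i j"])
       (simp add: sum_distrib_left case_prod_unfold algebra_simps)
qed

lemma C1_on_0: "C1_on S (\<lambda>p. 0)"
  unfolding C1_on_def by (rule exI[of _ "\<lambda>p. 0"]) (auto simp: zero_blinfun.rep_eq)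

lemma C1_on_add:
  assumes "C1_on S F" "C1_on S G"
  shows "C1_on S (\<lambda>p. F p + G p)"
proof -
  obtain F' G' :: "real^2 \<Rightarrow> ((real^2) \<Rightarrow>\<^sub>L real)" where
    "\<forall>p\<in>S. (F has_derivative blinfun_apply (F' p)) (at p within S)" "continuous_on S F'"
    "\<forall>p\<in>S. (G has_derivative blinfun_apply (G' p)) (at p within S)" "continuous_on S G'"
    using assms unfolding C1_on_def by blast
  then show ?thesis
    unfolding C1_on_def
    by (intro exI[of _ "\<lambda>p. F' p + G' p"])
       (simp add: plus_blinfun.rep_eq continuous_on_add)
qed

lemma C1_on_scale:
  assumes "C1_on S F"
  shows "C1_on S (\<lambda>p. r * F p)"
proof -
  obtain F' :: "real^2 \<Rightarrow> ((real^2) \<Rightarrow>\<^sub>L real)" where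
    "\<forall>p\<in>S. (F has_derivative blinfun_apply (F' p)) (at p within S)" "continuous_on S F'"
    using assms unfolding C1_on_def by blast
  then show ?thesis
    unfolding C1_on_def
    by (intro exI[of _ "\<lambda>p. r *\<^sub>R F' p"])
       (simp add: scaleR_blinfun.rep_eq has_derivative_mult_right continuous_on_scaleR)
qed

lemma subspace_C1_splines: "fun_vs.subspace (C1_splines \<Delta> d)"
proof (rule fun_vs.subspaceI)
  show "0 \<in> C1_splines \<Delta> d"
    using polynomial_le_0[of d] C1_on_0[of "\<Union>\<Delta>"]
    unfolding C1_splines_def zero_fun_def mem_Collect_eq by blast
next
  fix F G assume "F \<in> C1_splines \<Delta> d" "G \<in> C1_splines \<Delta> d"
  then have F: "\<forall>p. p \<notin> \<Union>\<Delta> \<longrightarrow> F p = 0" "C1_on (\<Union>\<Delta>) F"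
      "\<forall>T\<in>\<Delta>. \<exists>P. polynomial_le d P \<and> (\<forall>p\<in>T. F p = P p)"
    and G: "\<forall>p. p \<notin> \<Union>\<Delta> \<longrightarrow> G p = 0" "C1_on (\<Union>\<Delta>) G"
      "\<forall>T\<in>\<Delta>. \<exists>P. polynomial_le d P \<and> (\<forall>p\<in>T. G p = P p)"
    unfolding C1_splines_def mem_Collect_eq by simp_all
  have "\<exists>P. polynomial_le d P \<and> (\<forall>p\<in>T. F p + G p = P p)" if T: "T \<in> \<Delta>" for T
  proof -
    obtain P Q where "polynomial_le d P" "\<forall>p\<in>T. F p = P p" "polynomial_le d Q" "\<forall>p\<in>T. G p = Q p"
      using F(3) G(3) T by blast
    then show ?thesis by (intro exI[of _ "\<lambda>p. P p + Q p"]) (simp add: polynomial_le_add)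
  qed
  then show "F + G \<in> C1_splines \<Delta> d"
    using F(1) G(1) C1_on_add[OF F(2) G(2)]
    unfolding C1_splines_def plus_fun_def mem_Collect_eq by simp
next
  fix r F assume "F \<in> C1_splines \<Delta> d"
  then have F: "\<forall>p. p \<notin> \<Union>\<Delta> \<longrightarrow> F p = 0" "C1_on (\<Union>\<Delta>) F"
      "\<forall>T\<in>\<Delta>. \<exists>P. polynomial_le d P \<and> (\<forall>p\<in>T. F p = P p)"
    unfolding C1_splines_def mem_Collect_eq by simp_all
  have "\<exists>P. polynomial_le d P \<and> (\<forall>p\<in>T. r * F p = P p)" if T: "T \<in> \<Delta>" for T
  proof -
    obtain P where "polynomial_le d P" "\<forall>p\<in>T. F p = P p"
      using F(3) T by blast
    then show ?thesis by (intro exI[of _ "\<lambda>p. r * P p"]) (simp add: polynomial_le_scale)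
  qed
  then show "scale_fun r F \<in> C1_splines \<Delta> d"
    using F(1) C1_on_scale[OF F(2)]
    unfolding C1_splines_def scale_fun_def mem_Collect_eq by simp
qed

definition num_monomials :: "nat \<Rightarrow> nat" where
  "num_monomials d = (d + 1) * (d + 2) div 2"

end

(* Walking once around the interior vertex v, number the cells cyclically and let l_k be a linear
   form vanishing on the edge between cell k - 1 and cell k. Two polynomials agree to first order
   along that edge iff their difference is l_k^2 R_k; so a spline is a polynomial P of degree at
   most d on cell 0 together with smoothing cofactors R_1, ..., R_n of degree at most d - 2, the only
   condition being that the jumps sum to zero around v: l_1^2 R_1 + ... + l_n^2 R_n = 0.
   By rank-nullity the dimension is m_d + n m_(d-2) minus the dimension of the image
   of (R_1, ..., R_n) |-> l_1^2 R_1 + ... + l_n^2 R_n. In the coordinates x = l_0, y = l_1 this image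
   is spanned by all monomials of degree between 2 and d if some l_k is not a multiple
   of x or y, since then xy is a combination of x^2, y^2 and l_k^2; otherwise it is spanned by
   the monomials divisible by x^2 or y^2. If only two directions occur, consecutive edges turn
   by less than a half turn, so the edges alternate between opposite rays of two lines
   and n = 4: this is the singular case. *)

theory Submission
  imports Defs
begin

section \<open>Triangles with a common vertex\<close>

text \<open>No angles are used: turning by less than a half turn is the sign of
  \<open>cross2\<close>, and Cramer's rule converts such signs into coordinates. That the walk
  exists and meets every cell has to be proved: face-to-face contact and the interior position of
  \<open>v\<close> give each cell a unique next cell, finiteness closes the walk, and a
  connectedness argument excludes cells off it. The derivative of a spline is taken within the
  region; continuity from the cell interiors identifies it with the derivatives of the cell
  polynomials also on the edges. With l as one of two affine coordinates, equality of values on an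
  edge kills the part of the jump of degree 0 in l, and equality of derivatives the part of degree
  1, since each is a univariate polynomial with infinitely many zeros. What remains is l^2 R. For d
  at least 2 the image misses exactly the monomials 1, x, y, and in the singular case also xy. The
  dimensions are therefore n m_(d-2) + 3 and 4 m_(d-2) + 4; the case formulas of the theorem are
  these numbers rewritten.\<close>

definition cross2 :: "real^2 \<Rightarrow> real^2 \<Rightarrow> real" where
  "cross2 a b = a $ 1 * b $ 2 - a $ 2 * b $ 1"

lemma cross2_self [simp]: "cross2 a a = 0"
  by (simp add: cross2_def)

lemma cross2_zero [simp]: "cross2 0 a = 0" "cross2 a 0 = 0"
  by (simp_all add: cross2_def)

lemma cross2_commute: "cross2 a b = - cross2 b a"
  by (simp add: cross2_def)

lemma cross2_linear [simp]:
  "cross2 (a + b) c = cross2 a c + cross2 b c"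
  "cross2 c (a + b) = cross2 c a + cross2 c b"
  "cross2 (a - b) c = cross2 a c - cross2 b c"
  "cross2 c (a - b) = cross2 c a - cross2 c b"
  "cross2 (r *\<^sub>R a) c = r * cross2 a c"
  "cross2 c (r *\<^sub>R a) = r * cross2 c a"
  by (simp_all add: cross2_def algebra_simps)

lemma cross2_minus [simp]: "cross2 (- a) b = - cross2 a b" "cross2 a (- b) = - cross2 a b"
  by (simp_all add: cross2_def)

lemma continuous_on_cross2 [continuous_intros]:
  assumes "continuous_on S f" "continuous_on S g"
  shows "continuous_on S (\<lambda>x. cross2 (f x) (g x))"
  unfolding cross2_def by (intro continuous_intros assms)

lemma vec2_eq_iff: "(p::real^2) = q \<longleftrightarrow> p $ 1 = q $ 1 \<and> p $ 2 = q $ 2"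
  by (simp add: vec_eq_iff forall_2)

text \<open>Cramer's rule.\<close>

lemma cross2_expand:
  assumes "cross2 a b \<noteq> 0"
  shows "q = (cross2 q b / cross2 a b) *\<^sub>R a + (cross2 a q / cross2 a b) *\<^sub>R b"
  using assms unfolding vec2_eq_iff cross2_def
  by (simp add: divide_simps) algebra

lemma parallelE:
  assumes "cross2 b a = 0" "b \<noteq> 0"
  obtains r where "a = r *\<^sub>R b"
proof (cases "b $ 1 = 0")
  case True
  then have "b $ 2 \<noteq> 0" using assms(2) by (simp add: vec2_eq_iff)
  with True assms(1) have "a = (a $ 2 / b $ 2) *\<^sub>R b"
    by (simp add: vec2_eq_iff cross2_def)
  then show ?thesis by (rule that)
next
  case False
  with assms(1) have "a = (a $ 1 / b $ 1) *\<^sub>R b"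
    by (simp add: vec2_eq_iff cross2_def field_simps)
  then show ?thesis by (rule that)
qed

definition triangle :: "real^2 \<Rightarrow> real^2 \<Rightarrow> real^2 \<Rightarrow> (real^2) set" where
  "triangle v a b = convex hull {v, v + a, v + b}"

text \<open>By Cramer's rule, the two determinants divided by \<open>cross2 a b\<close> are the
  barycentric coordinates of \<open>p\<close> at \<open>v + b\<close> and
  \<open>v + a\<close>.\<close>

lemma mem_triangle_iff:
  assumes "cross2 a b > 0"
  shows "p \<in> triangle v a b \<longleftrightarrow>
    0 \<le> cross2 a (p - v) \<and> 0 \<le> cross2 (p - v) b \<and>
    cross2 a (p - v) + cross2 (p - v) b \<le> cross2 a b"
proof
  assume "p \<in> triangle v a b"
  then obtain s t where p: "p - v = s *\<^sub>R a + t *\<^sub>R b" and st: "0 \<le> s" "0 \<le> t" "s + t \<le> 1"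
    unfolding triangle_def convex_hull_3_alt by auto
  have "cross2 a (p - v) = t * cross2 a b" "cross2 (p - v) b = s * cross2 a b"
    unfolding p by simp_all
  moreover have "s * cross2 a b + t * cross2 a b \<le> 1 * cross2 a b"
    unfolding distrib_right[symmetric] using assms st by (intro mult_right_mono) auto
  ultimately show "0 \<le> cross2 a (p - v) \<and> 0 \<le> cross2 (p - v) b \<and>
    cross2 a (p - v) + cross2 (p - v) b \<le> cross2 a b"
    using assms st by simp
next
  assume R: "0 \<le> cross2 a (p - v) \<and> 0 \<le> cross2 (p - v) b \<and>
    cross2 a (p - v) + cross2 (p - v) b \<le> cross2 a b"
  have "p - v = (cross2 (p - v) b / cross2 a b) *\<^sub>R a + (cross2 a (p - v) / cross2 a b) *\<^sub>R b"
    using assms by (intro cross2_expand) simp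
  then have "p = v + (cross2 (p - v) b / cross2 a b) *\<^sub>R (v + a - v) +
      (cross2 a (p - v) / cross2 a b) *\<^sub>R (v + b - v)"
    by (simp add: algebra_simps)
  moreover have "cross2 (p - v) b / cross2 a b + cross2 a (p - v) / cross2 a b \<le> 1"
    using R assms by (simp add: add_divide_distrib[symmetric] divide_le_eq)
  ultimately show "p \<in> triangle v a b"
    unfolding triangle_def convex_hull_3_alt using R assms
    by (intro CollectI exI conjI) auto
qed

lemma triangle_vertices [simp]:
  "v \<in> triangle v a b" "v + a \<in> triangle v a b" "v + b \<in> triangle v a b"
  unfolding triangle_def by (simp_all add: hull_inc)

lemma compact_triangle: "compact (triangle v a b)"
  unfolding triangle_def by (simp add: compact_convex_hull)

lemma closed_triangle: "closed (triangle v a b)"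
  by (simp add: compact_triangle compact_imp_closed)

lemma convex_triangle: "convex (triangle v a b)"
  unfolding triangle_def by (simp add: convex_convex_hull)

lemma interior_triangleI:
  assumes "cross2 a (p - v) > 0" "cross2 (p - v) b > 0"
    "cross2 a (p - v) + cross2 (p - v) b < cross2 a b"
  shows "p \<in> interior (triangle v a b)"
proof (rule interiorI)
  let ?U = "{p. 0 < cross2 a (p - v)} \<inter> {p. 0 < cross2 (p - v) b} \<inter>
    {p. cross2 a (p - v) + cross2 (p - v) b < cross2 a b}"
  show "open ?U"
    by (intro open_Int open_Collect_less continuous_intros)
  show "p \<in> ?U" using assms by simp
  show "?U \<subseteq> triangle v a b"
  proof
    fix q assume q: "q \<in> ?U"
    then have "cross2 a b > 0" by simp
    with q show "q \<in> triangle v a b" by (subst mem_triangle_iff) auto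
  qed
qed

text \<open>Near \<open>v\<close> the triangle coincides with its cone, so a direction strictly
  between the edges leads into the interior.\<close>

lemma interior_triangle_scaled:
  assumes "cross2 a q > 0" "cross2 q b > 0" "cross2 a b > 0"
  obtains e where "0 < e" "\<And>t. 0 < t \<Longrightarrow> t \<le> e \<Longrightarrow> v + t *\<^sub>R q \<in> interior (triangle v a b)"
proof
  define S where "S = cross2 a q + cross2 q b"
  \<comment> \<open>Makes \<open>e * S\<close> half of the bound \<open>cross2 a b\<close> that the
    outer edge imposes.\<close>
  define e where "e = cross2 a b / (2 * S)"
  have S: "S > 0" using assms by (simp add: S_def)
  show "0 < e" unfolding e_def using assms S by simp
  fix t :: real assume t: "0 < t" "t \<le> e"
  have "t * S \<le> e * S"
    using t S by (intro mult_right_mono) auto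
  also have "e * S < cross2 a b"
    unfolding e_def using assms S by simp
  finally show "v + t *\<^sub>R q \<in> interior (triangle v a b)"
    using assms t by (intro interior_triangleI) (simp_all add: S_def distrib_left)
qed

lemma interior_triangle_nonempty:
  assumes "cross2 a b > 0"
  shows "interior (triangle v a b) \<noteq> {}"
  using interior_triangle_scaled[of a "a + b" b v] assms
  by (metis empty_iff add_0 add.right_neutral cross2_linear(1,2) cross2_self order.refl)

lemma affine_independent_triangle:
  assumes "cross2 a b \<noteq> 0"
  shows "\<not> affine_dependent {v, v + a, v + b}"
proof
  assume "affine_dependent {v, v + a, v + b}"
  moreover have "a \<noteq> 0" "b \<noteq> 0" "a \<noteq> b" using assms by auto
  moreover from this have "card {v, v + a, v + b} = 3" by auto
  ultimately have "collinear {v, v + a, v + b}"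
    using collinear_3_eq_affine_dependent by blast
  then have "collinear {0, a, b}"
    using collinear_3[of "v + a" v "v + b"] by (simp add: insert_commute)
  then show False
    using assms \<open>a \<noteq> 0\<close> \<open>b \<noteq> 0\<close> unfolding collinear_lemma by auto
qed

lemma extreme_point_of_triangle:
  assumes "cross2 a b \<noteq> 0"
  shows "x extreme_point_of triangle v a b \<longleftrightarrow> x \<in> {v, v + a, v + b}"
  unfolding triangle_def
  by (rule extreme_point_of_convex_hull_affine_independent) (rule affine_independent_triangle[OF assms])

text \<open>Positive orientation is reached by exchanging the two vertices other than
  \<open>v\<close> if necessary.\<close>

lemma simplex2_triangleE:
  assumes "(2::int) simplex T" "v extreme_point_of T"
  obtains a b where "T = triangle v a b" "cross2 a b > 0"
proof -
  obtain C where C: "\<not> affine_dependent C" "int (card C) = 2 + 1" and T: "T = convex hull C"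
    using assms(1) unfolding simplex_def by blast
  have "v \<in> C" using assms(2) unfolding T by (rule extreme_point_of_convex_hull)
  moreover from C(2) have "card C = 3" by simp
  ultimately have "card (C - {v}) = 2" using card_Diff_singleton by fastforce
  then obtain p q where "C - {v} = {p, q}" "p \<noteq> q" by (meson card_2_iff)
  with \<open>v \<in> C\<close> have Ceq: "C = {v, p, q}" and "p \<noteq> v" "q \<noteq> v" by auto
  have ne: "cross2 (p - v) (q - v) \<noteq> 0"
  proof
    assume "cross2 (p - v) (q - v) = 0"
    moreover have "p - v \<noteq> 0" using \<open>p \<noteq> v\<close> by simp
    ultimately obtain r where "q - v = r *\<^sub>R (p - v)" by (rule parallelE)
    then have "collinear {0, p - v, q - v}" unfolding collinear_lemma by blast
    then have "collinear {p, v, q}" by (simp add: collinear_3[of p v q])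
    then have "affine_dependent {v, p, q}"
      using \<open>card C = 3\<close> Ceq collinear_3_eq_affine_dependent \<open>p \<noteq> q\<close> \<open>p \<noteq> v\<close> \<open>q \<noteq> v\<close>
      by (metis insert_commute)
    then show False using C(1) Ceq by simp
  qed
  have TT: "T = triangle v (p - v) (q - v)" "T = triangle v (q - v) (p - v)"
    unfolding triangle_def T Ceq by (simp_all add: insert_commute)
  show ?thesis
  proof (cases "cross2 (p - v) (q - v) > 0")
    case True
    with TT show ?thesis using that by blast
  next
    case False
    with ne have "cross2 (q - v) (p - v) > 0"
      using cross2_commute[of "p - v" "q - v"] by linarith
    with TT show ?thesis using that by blast
  qed
qed

section \<open>Face-to-face fans of triangles around an interior vertex\<close>

text \<open>\<open>st T\<close> and \<open>en T\<close> are the edge vectors from \<open>v\<close>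
  at which the cell starts and ends in counterclockwise order. \<open>face\<close> is the condition
  that cells meet in common faces.\<close>

locale triangle_fan =
  fixes \<Delta> :: "(real^2) set set" and v :: "real^2" and st en :: "(real^2) set \<Rightarrow> real^2"
  assumes finite_cells: "finite \<Delta>"
    and face: "\<And>T T'. T \<in> \<Delta> \<Longrightarrow> T' \<in> \<Delta> \<Longrightarrow> T \<inter> T' face_of T"
    and center_interior: "v \<in> interior (\<Union>\<Delta>)"
    and cell_eq: "\<And>T. T \<in> \<Delta> \<Longrightarrow> T = triangle v (st T) (en T)"
    and orient: "\<And>T. T \<in> \<Delta> \<Longrightarrow> cross2 (st T) (en T) > 0"
begin

lemma mem_cell_iff:
  assumes "T \<in> \<Delta>"
  shows "p \<in> T \<longleftrightarrow> 0 \<le> cross2 (st T) (p - v) \<and> 0 \<le> cross2 (p - v) (en T) \<and>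
    cross2 (st T) (p - v) + cross2 (p - v) (en T) \<le> cross2 (st T) (en T)"
  using mem_triangle_iff[OF orient[OF assms], of p v] cell_eq[OF assms] by simp

lemma closed_cell: "T \<in> \<Delta> \<Longrightarrow> closed T"
  using cell_eq closed_triangle by metis

lemma convex_cell: "T \<in> \<Delta> \<Longrightarrow> convex T"
  using cell_eq convex_triangle by metis

lemma cell_vertices: "T \<in> \<Delta> \<Longrightarrow> v \<in> T \<and> v + st T \<in> T \<and> v + en T \<in> T"
  using cell_eq triangle_vertices by metis

lemma extreme_point_of_cell:
  "T \<in> \<Delta> \<Longrightarrow> x extreme_point_of T \<longleftrightarrow> x \<in> {v, v + st T, v + en T}"
  using extreme_point_of_triangle[of "st T" "en T" x v] orient[of T] cell_eq[of T] by simp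

lemma interior_meets_imp_eq:
  assumes "T \<in> \<Delta>" "T' \<in> \<Delta>" "p \<in> interior T" "p \<in> T'"
  shows "T \<subseteq> T'"
proof -
  have "T \<inter> T' = T"
    using face_of_disjoint_interior[OF face[OF assms(1,2)]] assms(3,4) interior_subset by blast
  then show ?thesis by blast
qed

text \<open>Short multiples of the common direction \<open>q\<close> lie in the interiors of both
  cells, and a face of a cell that meets its interior is the whole cell.\<close>

lemma overlap_imp_eq:
  assumes "T \<in> \<Delta>" "T' \<in> \<Delta>"
    and "cross2 (st T) q > 0" "cross2 q (en T) > 0" "cross2 (st T') q > 0" "cross2 q (en T') > 0"
  shows "T = T'"
proof -
  obtain e where e: "0 < e" "\<And>t. 0 < t \<Longrightarrow> t \<le> e \<Longrightarrow> v + t *\<^sub>R q \<in> interior T"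
    using interior_triangle_scaled[OF assms(3,4) orient[OF assms(1)], of v] cell_eq[OF assms(1)] by metis
  obtain e' where e': "0 < e'" "\<And>t. 0 < t \<Longrightarrow> t \<le> e' \<Longrightarrow> v + t *\<^sub>R q \<in> interior T'"
    using interior_triangle_scaled[OF assms(5,6) orient[OF assms(2)], of v] cell_eq[OF assms(2)] by metis
  have "v + min e e' *\<^sub>R q \<in> interior T" "v + min e e' *\<^sub>R q \<in> interior T'"
    using e e' by simp_all
  then show ?thesis
    using interior_meets_imp_eq assms(1,2) interior_subset by blast
qed

text \<open>If \<open>q\<close> is on the boundary of the cone of \<open>T\<close>, a small push
  towards the middle direction of \<open>T\<close> moves it inside, while the strict inequalities
  for \<open>T'\<close> survive.\<close>

lemma weak_overlap_imp_eq:
  assumes "T \<in> \<Delta>" "T' \<in> \<Delta>"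
    and weak: "cross2 (st T) q \<ge> 0" "cross2 q (en T) \<ge> 0"
    and strict: "cross2 (st T') q > 0" "cross2 q (en T') > 0"
  shows "T = T'"
proof -
  define m where "m = st T + en T"
  define x where "x = cross2 (st T') m"
  define y where "y = cross2 m (en T')"
  define M where "M = min (cross2 (st T') q) (cross2 q (en T'))"
  \<comment> \<open>Small enough that \<open>e * \<bar>x\<bar>\<close> and
    \<open>e * \<bar>y\<bar>\<close> stay below the slack \<open>M\<close> of the strict
    inequalities.\<close>
  define e where "e = M / (1 + \<bar>x\<bar> + \<bar>y\<bar>)"
  have M: "M > 0" using strict by (simp add: M_def)
  then have e: "e > 0" by (simp add: e_def)
  have "e * (1 + \<bar>x\<bar> + \<bar>y\<bar>) = M" by (simp add: e_def)
  then have "M = e + e * \<bar>x\<bar> + e * \<bar>y\<bar>" by (simp add: algebra_simps)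
  moreover have "e * \<bar>x\<bar> = \<bar>e * x\<bar>" "e * \<bar>y\<bar> = \<bar>e * y\<bar>" using e by (simp_all add: abs_mult)
  ultimately have "M + e * x > 0" "M + e * y > 0" using e by linarith+
  moreover have "M \<le> cross2 (st T') q" "M \<le> cross2 q (en T')" by (simp_all add: M_def)
  ultimately have "cross2 (st T') (q + e *\<^sub>R m) > 0" "cross2 (q + e *\<^sub>R m) (en T') > 0"
    unfolding cross2_linear x_def[symmetric] y_def[symmetric] by linarith+
  moreover have "cross2 (st T) (q + e *\<^sub>R m) > 0" "cross2 (q + e *\<^sub>R m) (en T) > 0"
    using weak e orient[OF assms(1)] by (simp_all add: m_def add_nonneg_pos)
  ultimately show ?thesis using overlap_imp_eq assms(1,2) by blast
qed

text \<open>The middle direction of the narrower cell lies in the cone of the wider one.\<close>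

lemma same_start_imp_eq:
  assumes "T \<in> \<Delta>" "T' \<in> \<Delta>" "st T = st T'"
  shows "T = T'"
proof -
  have *: "S = S'" if "S \<in> \<Delta>" "S' \<in> \<Delta>" "st S = st S'" "cross2 (en S) (en S') \<ge> 0" for S S'
    using weak_overlap_imp_eq[of S' S "st S + en S"] that orient[of S] orient[of S'] by simp
  show ?thesis
    using *[of T T'] *[of T' T] assms cross2_commute[of "en T" "en T'"] by (metis linear neg_0_le_iff_le)
qed

lemma same_end_imp_eq:
  assumes "T \<in> \<Delta>" "T' \<in> \<Delta>" "en T = en T'"
  shows "T = T'"
proof -
  have *: "S = S'" if "S \<in> \<Delta>" "S' \<in> \<Delta>" "en S = en S'" "cross2 (st S') (st S) \<ge> 0" for S S'
    using weak_overlap_imp_eq[of S' S "st S + en S"] that orient[of S] orient[of S'] by simp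
  show ?thesis
    using *[of T T'] *[of T' T] assms cross2_commute[of "st T" "st T'"] by (metis linear neg_0_le_iff_le)
qed

text \<open>The common face contains a point of the edge from \<open>v\<close> to
  \<open>v + c\<close> other than \<open>v\<close>, hence also the endpoint \<open>v + c\<close>.
  Extreme points pass from \<open>T\<close> to the common face and from there to
  \<open>T'\<close>.\<close>

lemma end_vertex_shared:
  assumes "T \<in> \<Delta>" "T' \<in> \<Delta>" "0 < s" "s \<le> 1" "c \<in> {st T, en T}" "v + s *\<^sub>R c \<in> T" "v + s *\<^sub>R c \<in> T'"
  shows "c \<in> {st T', en T'}"
proof -
  have F: "T \<inter> T' face_of T" "T \<inter> T' face_of T'"
    using face[OF assms(1,2)] face[OF assms(2,1)] by (simp_all add: Int_commute)
  have c0: "c \<noteq> 0" using orient[OF assms(1)] assms(5) by auto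
  have v: "v \<in> T" "v + c \<in> T" using cell_vertices[OF assms(1)] assms(5) by auto
  have "v + c \<in> T \<inter> T'"
  proof (cases "s = 1")
    \<comment> \<open>The endpoint itself is not in the open segment to which the face property
      applies.\<close>
    case True then show ?thesis using assms(6,7) by simp
  next
    case False
    have "v + s *\<^sub>R c \<in> open_segment v (v + c)"
      unfolding in_segment using False assms(3,4) c0
      by (intro conjI exI[of _ s]) (auto simp: algebra_simps)
    then show ?thesis using face_ofD[OF F(1)] v assms(6,7) by blast
  qed
  moreover have "(v + c) extreme_point_of T"
    using extreme_point_of_cell[OF assms(1)] assms(5) by auto
  ultimately have "(v + c) extreme_point_of T'"
    using extreme_point_of_face[OF F(1)] extreme_point_of_face[OF F(2)] by blast
  then show ?thesis using extreme_point_of_cell[OF assms(2)] c0 by auto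
qed

text \<open>Step across the end edge of \<open>T\<close> from one of its points \<open>p\<close>
  near \<open>v\<close>: the new point stays in the region and, being close to \<open>p\<close>, in
  a cell that contains \<open>p\<close>. This cell has the edge in common with \<open>T\<close> and
  lies on its other side.\<close>

lemma ex_next:
  assumes T: "T \<in> \<Delta>"
  shows "\<exists>T'\<in>\<Delta>. st T' = en T"
proof -
  define b where "b = en T"
  obtain r where r: "0 < r" "ball v r \<subseteq> \<Union>\<Delta>"
    using center_interior by (meson mem_interior)
  have b0: "b \<noteq> 0" using orient[OF T] b_def by auto
  \<comment> \<open>Puts \<open>p\<close> both on the edge and in the ball around
    \<open>v\<close>.\<close>
  define s where "s = min 1 (r / (2 * norm b))"
  have s: "0 < s" "s \<le> 1" using r b0 by (simp_all add: s_def)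
  have "s * norm b \<le> r / (2 * norm b) * norm b" unfolding s_def by (intro mult_right_mono) auto
  also have "\<dots> < r" using b0 r by simp
  finally have sr: "s * norm b < r" .
  define p where "p = v + s *\<^sub>R b"
  have pint: "p \<in> ball v r" using sr s by (simp add: p_def dist_norm)
  have "v + s *\<^sub>R b \<in> T"
  proof -
    have "(1 - s) *\<^sub>R v + s *\<^sub>R (v + b) \<in> T"
      using convex_cell[OF T] cell_vertices[OF T] s unfolding b_def convex_alt by simp
    then show ?thesis by (simp add: algebra_simps)
  qed
  \<comment> \<open>The finitely many cells that miss \<open>p\<close> form a closed set, so points
    close to \<open>p\<close> avoid all of them.\<close>
  define C where "C = \<Union>{T'\<in>\<Delta>. p \<notin> T'}"
  have "closed C" unfolding C_def using finite_cells closed_cell by (intro closed_Union) auto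
  moreover have "p \<notin> C" by (auto simp: C_def)
  ultimately have "open (ball v r - C)" "p \<in> ball v r - C" using pint by auto
  then obtain e where e: "0 < e" "ball p e \<subseteq> ball v r - C" by (meson open_contains_ball)
  \<comment> \<open>\<open>b\<close> after a counterclockwise quarter turn.\<close>
  define n where "n = (vector [- b $ 2, b $ 1] :: real^2)"
  have n: "cross2 b n > 0" unfolding cross2_def n_def
    using b0 by (simp add: vec2_eq_iff)
      (metis not_sum_power2_lt_zero power2_eq_square linorder_neqE_linordered_idom
        sum_power2_gt_zero_iff)
  define t where "t = e / (2 * (1 + norm n))"
  have t: "0 < t" using e by (simp add: t_def add_pos_nonneg)
  have "t * norm n \<le> e / 2" unfolding t_def using e by (simp add: field_simps add_pos_nonneg)
  then have "t * norm n < e" using e by simp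
  then have "p + t *\<^sub>R n \<in> ball p e" using t by (simp add: dist_norm)
  then have "p + t *\<^sub>R n \<in> \<Union>\<Delta>" "p + t *\<^sub>R n \<notin> C" using e r by blast+
  then obtain T' where T': "T' \<in> \<Delta>" "p + t *\<^sub>R n \<in> T'" "p \<in> T'" by (auto simp: C_def)
  have "b \<in> {st T', en T'}"
    using end_vertex_shared[OF T T'(1) s, of b] \<open>v + s *\<^sub>R b \<in> T\<close> T'(3) by (simp add: b_def p_def)
  moreover have "b \<noteq> en T'"
  proof
    assume "b = en T'"
    then have "0 \<le> cross2 (p + t *\<^sub>R n - v) b" using mem_cell_iff[OF T'(1)] T'(2) by blast
    then have "0 \<le> t * cross2 n b" by (simp add: p_def)
    moreover have "t * cross2 n b < 0" using n t cross2_commute[of n b] by (simp add: mult_pos_neg)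
    ultimately show False by simp
  qed
  ultimately show ?thesis using T'(1) b_def by auto
qed

text \<open>With both coordinates of \<open>p\<close> relative to the edges of \<open>T\<close>
  positive, \<open>T'\<close> would meet the interior of \<open>T\<close>; so \<open>p\<close> is on
  an edge of \<open>T\<close>, which is then an edge of \<open>T'\<close> too. Two cells cannot both
  start or both end there.\<close>

lemma shared_point:
  assumes "T \<in> \<Delta>" "T' \<in> \<Delta>" "T \<noteq> T'" "p \<in> T" "p \<in> T'" "p \<noteq> v"
  shows "st T' = en T \<or> st T = en T'"
proof -
  define a b where "a = st T" and "b = en T"
  have D: "cross2 a b > 0" using orient[OF assms(1)] by (simp add: a_def b_def)
  define x y where "x = cross2 (p - v) b / cross2 a b" and "y = cross2 a (p - v) / cross2 a b"
  have p: "p - v = x *\<^sub>R a + y *\<^sub>R b"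
    unfolding x_def y_def using D by (intro cross2_expand) simp
  have "0 \<le> x" "0 \<le> y" "x + y \<le> 1"
    using mem_cell_iff[OF assms(1), of p] assms(4) D
    by (simp_all add: x_def y_def a_def b_def add_divide_distrib[symmetric] divide_le_eq)
  have "x = 0 \<or> y = 0"
  proof (rule ccontr)
    assume "\<not> (x = 0 \<or> y = 0)"
    with \<open>0 \<le> x\<close> \<open>0 \<le> y\<close> have xy: "x > 0" "y > 0" by simp_all
    \<comment> \<open>\<open>p\<close> may lie on the outer edge opposite \<open>v\<close>; the
      midpoint of \<open>v\<close> and \<open>p\<close> does not.\<close>
    have "v + (1/2) *\<^sub>R (p - v) = (1 - 1/2) *\<^sub>R v + (1/2) *\<^sub>R p"
      by (simp add: algebra_simps scaleR_add_left[symmetric] del: scaleR_add_left)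
    then have h: "v + (1/2) *\<^sub>R (p - v) \<in> T'"
      using convex_cell[OF assms(2)] cell_vertices[OF assms(2)] assms(5) unfolding convex_alt
      by (metis atLeastAtMost_iff half_gt_zero_iff le_divide_eq_1 less_eq_real_def
        zero_less_one field_sum_of_halves linorder_not_less add_le_cancel_left
        add.right_neutral)
    have "v + (1/2) *\<^sub>R (p - v) \<in> interior (triangle v a b)"
    proof (rule interior_triangleI)
      have "(x + y) * cross2 a b \<le> 1 * cross2 a b"
        using \<open>x + y \<le> 1\<close> D by (intro mult_right_mono) auto
      then have "x * cross2 a b + y * cross2 a b < 2 * cross2 a b"
        using D by (simp add: distrib_right)
      then show "cross2 a (v + (1/2) *\<^sub>R (p - v) - v) + cross2 (v + (1/2) *\<^sub>R (p - v) - v) b < cross2 a b"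
        unfolding p by simp
    qed (use xy D in \<open>simp_all add: p\<close>)
    then have "T \<subseteq> T'"
      using interior_meets_imp_eq[OF assms(1,2) _ h] cell_eq[OF assms(1)] a_def b_def by simp
    then have "T = T \<inter> T'" by blast
    then have "T face_of T'" using face[OF assms(2,1)] by (simp add: Int_commute)
    moreover have "interior T \<noteq> {}"
      using interior_triangle_nonempty[OF orient[OF assms(1)], of v] cell_eq[OF assms(1)] by simp
    then have "T \<inter> interior T' \<noteq> {}"
      using interior_mono[OF \<open>T \<subseteq> T'\<close>] interior_subset[of T] by blast
    ultimately show False using face_of_disjoint_interior assms(3) by blast
  qed
  then show ?thesis
  proof
    assume "x = 0"
    with p have pb: "p = v + y *\<^sub>R b" by (simp add: algebra_simps)
    with assms(6) \<open>0 \<le> y\<close> have "y > 0" by (cases "y = 0") auto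
    with end_vertex_shared[OF assms(1,2), of y b] pb assms(4,5) \<open>x + y \<le> 1\<close> \<open>0 \<le> x\<close>
    have "b \<in> {st T', en T'}" by (simp add: b_def)
    then show ?thesis using same_end_imp_eq[OF assms(1,2)] assms(3) b_def by auto
  next
    assume "y = 0"
    with p have pb: "p = v + x *\<^sub>R a" by (simp add: algebra_simps)
    with assms(6) \<open>0 \<le> x\<close> have "x > 0" by (cases "x = 0") auto
    with end_vertex_shared[OF assms(1,2), of x a] pb assms(4,5) \<open>x + y \<le> 1\<close> \<open>0 \<le> y\<close>
    have "a \<in> {st T', en T'}" by (simp add: a_def)
    then show ?thesis using same_start_imp_eq[OF assms(1,2)] assms(3) a_def by auto
  qed
qed

end

section \<open>The cyclic order of the cells\<close>

lemma principal_ideal_scale: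
  assumes "k \<noteq> 0"
  shows "principal_ideal (\<lambda>p. k * f p) = principal_ideal f"
proof -
  have "principal_ideal (\<lambda>p. c * g p) \<subseteq> principal_ideal g" for c g
  proof
    fix h assume "h \<in> principal_ideal (\<lambda>p. c * g p)"
    then obtain q where q: "h = (\<lambda>p. q p * (c * g p))" "real_polynomial_function q"
      unfolding principal_ideal_def by blast
    have "h = (\<lambda>p. (c * q p) * g p)" "real_polynomial_function (\<lambda>p. c * q p)"
      using q by (auto intro: real_polynomial_function.intros)
    then show "h \<in> principal_ideal g"
      unfolding principal_ideal_def by (intro CollectI exI[of _ "\<lambda>p. c * q p"]) simp
  qed
  from this[of k f] this[of "1 / k" "\<lambda>p. k * f p"] show ?thesis
    using assms by (auto simp: fun_eq_iff)
qed

context triangle_fan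
begin

text \<open>The choice is unique by \<open>same_start_imp_eq\<close>.\<close>

definition next_cell :: "(real^2) set \<Rightarrow> (real^2) set" where
  "next_cell T = (SOME T'. T' \<in> \<Delta> \<and> st T' = en T)"

text \<open>Indexed by all natural numbers and periodic, so that successors need no modular
  arithmetic.\<close>

definition cell :: "nat \<Rightarrow> (real^2) set" where
  "cell i = (next_cell ^^ i) (SOME T. T \<in> \<Delta>)"

definition w :: "nat \<Rightarrow> real^2" where
  "w i = st (cell i)"

lemma next_cell:
  assumes "T \<in> \<Delta>"
  shows "next_cell T \<in> \<Delta>" "st (next_cell T) = en T"
proof -
  have "next_cell T \<in> \<Delta> \<and> st (next_cell T) = en T"
    unfolding next_cell_def by (rule someI_ex) (use ex_next[OF assms] in blast)
  then show "next_cell T \<in> \<Delta>" "st (next_cell T) = en T" by simp_all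
qed

lemma cell_0_in: "cell 0 \<in> \<Delta>"
proof -
  have "\<exists>T. T \<in> \<Delta>" using center_interior interior_subset by blast
  then have "(SOME T. T \<in> \<Delta>) \<in> \<Delta>" by (rule someI_ex)
  then show ?thesis by (simp add: cell_def)
qed

lemma cell_Suc: "cell (Suc i) = next_cell (cell i)"
  by (simp add: cell_def)

lemma cell_in [simp]: "cell i \<in> \<Delta>"
  by (induction i) (simp_all add: cell_0_in cell_Suc next_cell)

lemma en_cell: "en (cell i) = w (Suc i)"
  by (simp add: w_def cell_Suc next_cell)

lemma cell_w: "cell i = triangle v (w i) (w (Suc i))"
  using cell_eq[of "cell i"] by (simp add: en_cell w_def)

lemma orient_w: "cross2 (w i) (w (Suc i)) > 0"
  using orient[of "cell i"] by (simp add: en_cell w_def)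

lemma w_nonzero: "w i \<noteq> 0"
  using orient_w[of i] by auto

text \<open>The successor map is injective on the cells. Therefore the walk returns to its first
  cell instead of running into a cycle that leaves it out.\<close>

lemma cell_Suc_cancel:
  assumes "cell (Suc i) = cell (Suc j)"
  shows "cell i = cell j"
  using same_end_imp_eq[of "cell i" "cell j"] assms by (simp add: en_cell w_def)

lemma cell_cancel: "cell (k + i) = cell (k + j) \<Longrightarrow> cell i = cell j"
  by (induction k) (auto dest: cell_Suc_cancel)

definition period :: nat where
  "period = (LEAST m. 0 < m \<and> cell m = cell 0)"

lemma period: "0 < period" "cell period = cell 0"
proof -
  have "range cell \<subseteq> \<Delta>" by auto
  then have "finite (range cell)" using finite_cells by (rule finite_subset)
  then have "\<not> inj cell" using range_inj_infinite[of cell] by metis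
  then obtain i j where "cell i = cell j" "i < j"
    unfolding inj_def by (metis linorder_neqE_nat)
  then have "0 < j - i \<and> cell (j - i) = cell 0"
    using cell_cancel[of i "j - i" 0] by simp
  then have "0 < period \<and> cell period = cell 0"
    unfolding period_def by (rule LeastI)
  then show "0 < period" "cell period = cell 0" by simp_all
qed

lemma cell_mod: "cell (i mod period) = cell i"
  using period(2) unfolding cell_def by (intro funpow_mod_eq) simp

lemma inj_on_cell: "inj_on cell {..<period}"
proof -
  have "i = j" if "i \<le> j" "j < period" "cell i = cell j" for i j
  proof (rule ccontr)
    assume "i \<noteq> j"
    then have "0 < j - i \<and> cell (j - i) = cell 0"
      using cell_cancel[of i "j - i" 0] that by simp
    then have "period \<le> j - i" unfolding period_def by (rule Least_le)
    with that period(1) show False by simp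
  qed
  then show ?thesis unfolding inj_on_def by (metis lessThan_iff linear)
qed

text \<open>The cones spanned by the cells of the orbit form a set that is closed, and away from the
  apex also open; since the punctured plane is connected, they cover the plane, so no cell is
  left outside the orbit.\<close>

lemma cones_cover:
  assumes "q \<noteq> 0"
  shows "\<exists>i. 0 \<le> cross2 (w i) q \<and> 0 \<le> cross2 q (w (Suc i))"
proof -
  define K where "K i = {q. 0 \<le> cross2 (w i) q} \<inter> {q. 0 \<le> cross2 q (w (Suc i))}" for i
  define U where "U = (\<Union>i. K i)"
  have "w (i mod period) = w i" "w (Suc (i mod period)) = w (Suc i)" for i
    using cell_mod[of i] by (simp_all add: w_def cell_Suc)
  then have "K i = K (i mod period)" for i by (simp add: K_def)
  moreover have "i mod period < period" for i using period by simp
  ultimately have "U = (\<Union>i<period. K i)" unfolding U_def by blast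
  moreover have "closed (K i)" for i
    unfolding K_def by (intro closed_Int closed_Collect_le continuous_intros)
  ultimately have "closed U" by (simp add: closed_UN)
  \<comment> \<open>The sign of \<open>cross2 q (w (Suc i))\<close> decides which of the two
    adjacent cones contains \<open>q\<close>.\<close>
  have nbhd: "q \<in> K i \<union> K (Suc i)"
    if "0 < cross2 (w i) q" "0 < cross2 q (w (Suc (Suc i)))" for i q
    using that cross2_commute[of q "w (Suc i)"] by (auto simp: K_def)
  have "\<exists>N. open N \<and> q \<in> N \<and> N \<subseteq> U - {0}" if q: "q \<in> U - {0}" for q
  proof -
    obtain i where i: "0 \<le> cross2 (w i) q" "0 \<le> cross2 q (w (Suc i))" "q \<noteq> 0"
      using q by (auto simp: U_def K_def)
    have D: "cross2 (w i) (w (Suc i)) > 0" by (rule orient_w)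
    define x y where "x = cross2 q (w (Suc i)) / cross2 (w i) (w (Suc i))"
      and "y = cross2 (w i) q / cross2 (w i) (w (Suc i))"
    have qxy: "q = x *\<^sub>R w i + y *\<^sub>R w (Suc i)"
      unfolding x_def y_def using D by (intro cross2_expand) simp
    have xy: "0 \<le> x" "0 \<le> y" using i D by (simp_all add: x_def y_def)
    \<comment> \<open>An open neighbourhood of the ray of \<open>w (Suc j)\<close>, for points on
      the common boundary of two cones.\<close>
    define N where "N j = {q. 0 < cross2 (w j) q} \<inter> {q. 0 < cross2 q (w (Suc (Suc j)))}" for j
    have N: "open (N j)" "N j \<subseteq> U - {0}" for j
      using nbhd[of j] by (auto simp: N_def U_def intro!: open_Int open_Collect_less continuous_intros)
    consider "0 < x" "0 < y" | "x = 0" "0 < y" | "y = 0" "0 < x"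
      using xy i(3) qxy by force
    then show ?thesis
    proof cases
      case 1
      let ?N = "{q. 0 < cross2 (w i) q} \<inter> {q. 0 < cross2 q (w (Suc i))}"
      have "open ?N" by (intro open_Int open_Collect_less continuous_intros)
      moreover have "q \<in> ?N" using 1 D by (simp add: qxy)
      moreover have "?N \<subseteq> U - {0}" by (auto simp: U_def K_def intro!: exI[of _ i])
      ultimately show ?thesis by blast
    next
      case 2
      then have "q \<in> N i" using D orient_w[of "Suc i"] by (simp add: N_def qxy)
      with N show ?thesis by blast
    next
      case 3
      \<comment> \<open>The predecessor of \<open>i\<close> modulo the period; \<open>i\<close>
        itself may be 0.\<close>
      define j where "j = i + period - 1"
      have "Suc j = i + period" using period(1) by (simp add: j_def)
      then have "cell (Suc j) = cell i" using cell_mod[of "i + period"] cell_mod[of i] by simp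
      then have "w (Suc j) = w i" "w (Suc (Suc j)) = w (Suc i)" by (simp_all add: w_def cell_Suc)
      then have "q \<in> N j" using 3 D orient_w[of j] by (simp add: N_def qxy)
      with N show ?thesis by blast
    qed
  qed
  then have "open (U - {0})" by (subst open_subopen) blast
  moreover have "open (- U)" using \<open>closed U\<close> by blast
  moreover have "connected (- {0 :: real^2})"
    by (rule connected_punctured_universe) simp
  ultimately have "(U - {0}) \<inter> - {0} = {} \<or> - U \<inter> - {0} = {}"
    by (intro connectedD[of "- {0}"]) auto
  moreover have "w 0 \<in> U - {0}"
    using w_nonzero[of 0] orient_w[of 0] by (auto simp: U_def K_def intro!: exI[of _ 0])
  ultimately have "q \<in> U" using assms by blast
  then show ?thesis by (auto simp: U_def K_def)
qed

text \<open>The middle direction of \<open>T\<close> lies in the cone of some cell of the walk,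
  which then coincides with \<open>T\<close>.\<close>

lemma cell_surj:
  assumes "T \<in> \<Delta>"
  shows "\<exists>i. T = cell i"
proof -
  let ?q = "st T + en T"
  have T: "cross2 (st T) ?q > 0" "cross2 ?q (en T) > 0" using orient[OF assms] by simp_all
  then have "?q \<noteq> 0" by (metis cross2_zero(2) less_irrefl)
  then obtain i where "0 \<le> cross2 (w i) ?q" "0 \<le> cross2 ?q (w (Suc i))"
    using cones_cover by blast
  then have "cell i = T"
    using weak_overlap_imp_eq[of "cell i" T ?q] assms T by (simp add: en_cell w_def)
  then show ?thesis by blast
qed

lemma cells_image: "\<Delta> = cell ` {..<period}"
proof
  show "\<Delta> \<subseteq> cell ` {..<period}"
    using cell_surj cell_mod period(1) by (metis image_eqI lessThan_iff mod_less_divisor subsetI)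
qed auto

lemma period_eq_card: "period = card \<Delta>"
  using cells_image inj_on_cell by (metis card_image card_lessThan)

lemma cell_period_add: "cell (i + period) = cell i"
  using cell_mod[of "i + period"] cell_mod[of i] by simp

lemma w_period_add: "w (i + period) = w i"
  by (simp add: w_def cell_period_add)

lemma w_period: "w period = w 0"
  using w_period_add[of 0] by simp

lemma mem_cell_w_iff:
  "p \<in> cell i \<longleftrightarrow> 0 \<le> cross2 (w i) (p - v) \<and> 0 \<le> cross2 (p - v) (w (Suc i)) \<and>
    cross2 (w i) (p - v) + cross2 (p - v) (w (Suc i)) \<le> cross2 (w i) (w (Suc i))"
  using mem_cell_iff[of "cell i" p] by (simp add: en_cell w_def)

lemma same_start_cell: "w i = w j \<Longrightarrow> cell i = cell j"
  using same_start_imp_eq[of "cell i" "cell j"] by (simp add: w_def)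

lemma shared_point_cell:
  assumes "p \<in> cell i" "p \<in> cell j" "cell i \<noteq> cell j" "p \<noteq> v"
  shows "cell j = cell (Suc i) \<or> cell i = cell (Suc j)"
proof -
  have "w j = w (Suc i) \<or> w i = w (Suc j)"
    using shared_point[of "cell i" "cell j" p] assms by (simp add: en_cell w_def)
  then show ?thesis using same_start_cell by blast
qed

lemma cell_neq_Suc: "cell i \<noteq> cell (Suc i)"
  using orient_w[of i] by (metis cross2_self less_irrefl w_def)

text \<open>\<open>p\<close> is on neither side of \<open>w (Suc i)\<close>: one cell ends and the
  other starts there.\<close>

lemma common_edge_parallel:
  assumes "p \<in> cell i" "p \<in> cell (Suc i)"
  shows "cross2 (w (Suc i)) (p - v) = 0"
  using assms cross2_commute[of "p - v" "w (Suc i)"] unfolding mem_cell_w_iff by simp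

lemma cell_Int_Suc: "cell i \<inter> cell (Suc i) = closed_segment v (v + w (Suc i))"
proof
  show "cell i \<inter> cell (Suc i) \<subseteq> closed_segment v (v + w (Suc i))"
  proof
    fix p assume p: "p \<in> cell i \<inter> cell (Suc i)"
    define r where "r = cross2 (w i) (p - v) / cross2 (w i) (w (Suc i))"
    have z: "cross2 (p - v) (w (Suc i)) = 0"
      using common_edge_parallel[of p i] p cross2_commute[of "p - v"] by simp
    have "p - v = r *\<^sub>R w (Suc i)"
      using cross2_expand[of "w i" "w (Suc i)" "p - v"] orient_w[of i] z by (simp add: r_def)
    then have "p = v + r *\<^sub>R w (Suc i)" by (simp add: algebra_simps)
    moreover have "0 \<le> r" "r \<le> 1"
      using p mem_cell_w_iff[of p i] z orient_w[of i] by (simp_all add: r_def divide_le_eq)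
    ultimately show "p \<in> closed_segment v (v + w (Suc i))"
      unfolding in_segment by (intro exI[of _ r]) (simp add: algebra_simps)
  qed
  have "{v, v + w (Suc i)} \<subseteq> cell i \<inter> cell (Suc i)"
    using triangle_vertices by (auto simp: cell_w)
  moreover have "convex (cell i \<inter> cell (Suc i))"
    by (intro convex_Int convex_cell cell_in)
  ultimately show "closed_segment v (v + w (Suc i)) \<subseteq> cell i \<inter> cell (Suc i)"
    by (intro closed_segment_subset) auto
qed

lemma dual_edges_eq: "dual_edges \<Delta> = {{cell i, cell (Suc i)} | i. True}"
proof
  show "dual_edges \<Delta> \<subseteq> {{cell i, cell (Suc i)} | i. True}"
  proof
    fix e assume "e \<in> dual_edges \<Delta>"
    then obtain T T' where e: "e = {T, T'}" "T \<in> \<Delta>" "T' \<in> \<Delta>" "T \<noteq> T'" "(1::int) simplex (T \<inter> T')"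
      unfolding dual_edges_def by blast
    obtain i j where ij: "T = cell i" "T' = cell j" using e cell_surj by metis
    \<comment> \<open>A 1-simplex has dimension 1 and is not contained in a point.\<close>
    have "\<not> T \<inter> T' \<subseteq> {v}"
      using aff_dim_simplex[OF e(5)] aff_dim_subset[of "T \<inter> T'" "{v}"] by auto
    then obtain p where "p \<in> T \<inter> T'" "p \<noteq> v" by blast
    then have "T' = cell (Suc i) \<or> T = cell (Suc j)"
      using shared_point_cell[of p i j] ij e(4) by blast
    then show "e \<in> {{cell i, cell (Suc i)} | i. True}"
      using ij e(1) by (auto simp: insert_commute)
  qed
  show "{{cell i, cell (Suc i)} | i. True} \<subseteq> dual_edges \<Delta>"
  proof
    fix e assume "e \<in> {{cell i, cell (Suc i)} | i. True}"
    then obtain i where e: "e = {cell i, cell (Suc i)}" by blast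
    have "(1::int) simplex (cell i \<inter> cell (Suc i))"
      unfolding cell_Int_Suc by (rule one_simplex_segment) (simp add: w_nonzero)
    then show "e \<in> dual_edges \<Delta>"
      unfolding dual_edges_def e using cell_neq_Suc[of i] cell_in by blast
  qed
qed

section \<open>Edge labels and the singular case\<close>

definition label :: "nat \<Rightarrow> (real^2 \<Rightarrow> real) set" where
  "label i = principal_ideal (\<lambda>p. (cross2 (w i) (p - v))\<^sup>2)"

text \<open>The description operator requires uniqueness: an affine form that vanishes at both ends
  of the shared edge is a scalar multiple of the chosen one, and a nonzero constant does not change
  the ideal.\<close>

lemma edge_label_eq: "edge_label {cell i, cell (Suc i)} = label (Suc i)"
  unfolding edge_label_def
proof (rule the_equality)
  let ?b = "w (Suc i)"
  \<comment> \<open>A quarter turn of \<open>?b\<close>, so that the determinant becomes an inner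
    product.\<close>
  define m where "m = (vector [- ?b $ 2, ?b $ 1] :: real^2)"
  have mb: "cross2 ?b q = m \<bullet> q" for q
    by (simp add: m_def cross2_def inner_vec_def sum_2)
  have m0: "m \<noteq> 0" using w_nonzero[of "Suc i"] by (auto simp: m_def vec2_eq_iff)
  have mp: "cross2 ?b (p - v) = m \<bullet> p + - (m \<bullet> v)" for p
    by (simp add: mb inner_diff_right)
  have seg: "\<Inter>{cell i, cell (Suc i)} = closed_segment v (v + ?b)"
    using cell_Int_Suc[of i] by simp
  show "\<exists>a b. a \<noteq> 0 \<and> (\<forall>p\<in>\<Inter>{cell i, cell (Suc i)}. a \<bullet> p + b = 0) \<and>
    label (Suc i) = principal_ideal (\<lambda>p. (a \<bullet> p + b)\<^sup>2)"
  proof (intro exI[of _ m] exI[of _ "- (m \<bullet> v)"] conjI ballI)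
    show "m \<bullet> p + - (m \<bullet> v) = 0" if "p \<in> \<Inter>{cell i, cell (Suc i)}" for p
      using common_edge_parallel[of p i] that unfolding mp[symmetric] by simp
    show "label (Suc i) = principal_ideal (\<lambda>p. (m \<bullet> p + - (m \<bullet> v))\<^sup>2)"
      unfolding label_def mp ..
  qed (rule m0)
  fix I assume "\<exists>a b. a \<noteq> 0 \<and> (\<forall>p\<in>\<Inter>{cell i, cell (Suc i)}. a \<bullet> p + b = 0) \<and>
    I = principal_ideal (\<lambda>p. (a \<bullet> p + b)\<^sup>2)"
  then obtain a b where ab: "a \<noteq> 0" "\<And>p. p \<in> closed_segment v (v + ?b) \<Longrightarrow> a \<bullet> p + b = 0"
    "I = principal_ideal (\<lambda>p. (a \<bullet> p + b)\<^sup>2)" unfolding seg by blast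
  have av: "a \<bullet> v + b = 0" "a \<bullet> (v + ?b) + b = 0" by (rule ab(2), simp)+
  then have "a \<bullet> ?b = 0" by (simp add: inner_add_right)
  then have "cross2 m a = 0" by (simp add: m_def cross2_def inner_vec_def sum_2 algebra_simps)
  then obtain k where k: "a = k *\<^sub>R m" using m0 by (rule parallelE)
  have "a \<bullet> p + b = k * cross2 ?b (p - v)" for p
    using av(1) unfolding mp k by (simp add: algebra_simps)
  moreover have "k \<noteq> 0" using k ab(1) by auto
  ultimately show "I = label (Suc i)"
    unfolding ab(3) label_def by (simp add: power_mult_distrib principal_ideal_scale)
qed

text \<open>At \<open>v + w j\<close> every element of \<open>label j\<close> vanishes, while the
  generator of \<open>label i\<close> has the value \<open>(cross2 (w i) (w j))\<^sup>2\<close>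
  there.\<close>

lemma label_eq_iff: "label i = label j \<longleftrightarrow> cross2 (w i) (w j) = 0"
proof
  assume "label i = label j"
  moreover have "(\<lambda>p. (cross2 (w i) (p - v))\<^sup>2) \<in> label i"
    unfolding label_def principal_ideal_def
    by (intro CollectI exI[of _ "\<lambda>p. 1"]) (auto intro: real_polynomial_function.intros)
  ultimately obtain q where "(\<lambda>p. (cross2 (w i) (p - v))\<^sup>2) = (\<lambda>p. q p * (cross2 (w j) (p - v))\<^sup>2)"
    unfolding label_def principal_ideal_def by auto
  from fun_cong[OF this, of "v + w j"] show "cross2 (w i) (w j) = 0" by simp
next
  assume "cross2 (w i) (w j) = 0"
  then obtain r where r: "w j = r *\<^sub>R w i" using parallelE[OF _ w_nonzero] by blast
  then have "r \<noteq> 0" using w_nonzero[of j] by auto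
  then show "label i = label j"
    unfolding label_def r
    by (simp add: power_mult_distrib principal_ideal_scale del: cross2_linear(4))
qed

lemma labels_eq: "edge_label ` dual_edges \<Delta> = range label"
proof -
  have "edge_label ` dual_edges \<Delta> = range (\<lambda>i. label (Suc i))"
    using dual_edges_eq by (simp add: full_SetCompr_eq image_image edge_label_eq)
  also have "\<dots> = range label"
  proof
    show "range label \<subseteq> range (\<lambda>i. label (Suc i))"
    proof
      fix L assume "L \<in> range label"
      then obtain i where "L = label i" by blast
      \<comment> \<open>Dual edges produce labels with index at least 1; index 0 is recovered one
        period later.\<close>
      moreover have "label i = label (Suc (i + period - 1))"
        using period(1) w_period_add[of i] by (simp add: label_def)
      ultimately show "L \<in> range (\<lambda>i. label (Suc i))" by blast
    qed
  qed auto
  finally show ?thesis .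
qed

lemma label_0_neq_1: "label 0 \<noteq> label 1"
  using orient_w[of 0] by (simp add: label_eq_iff)

text \<open>\<open>label 0\<close> and \<open>label 1\<close> are different, so they already are the
  two available labels.\<close>

lemma singular_imp_two_directions:
  assumes "has_singular_vertex \<Delta>"
  shows "cross2 (w 0) (w k) = 0 \<or> cross2 (w 1) (w k) = 0"
proof -
  have "card (range label) = 2"
    using assms unfolding has_singular_vertex_def labels_eq by blast
  then obtain A B where "range label = {A, B}" by (auto simp: card_2_iff)
  then have "label 0 \<in> {A, B}" "label 1 \<in> {A, B}" "label k \<in> {A, B}" by blast+
  then have "label 0 = label k \<or> label 1 = label k" using label_0_neq_1 by auto
  then show ?thesis by (simp add: label_eq_iff)
qed

text \<open>Adjacent labels differ, so with two labels they alternate. Each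
  \<open>w (Suc (Suc i))\<close> is a negative multiple of \<open>w i\<close>, and four steps make a
  full turn.\<close>

lemma two_directions_imp_singular:
  assumes n: "3 \<le> period"
    and two: "\<And>k. cross2 (w 0) (w k) = 0 \<or> cross2 (w 1) (w k) = 0"
  shows "has_singular_vertex \<Delta>"
proof -
  have opp: "\<exists>r>0. w (Suc (Suc i)) = - r *\<^sub>R w i" if par: "cross2 (w i) (w (Suc (Suc i))) = 0" for i
  proof -
    obtain r where r: "w (Suc (Suc i)) = r *\<^sub>R w i" by (rule parallelE[OF par w_nonzero])
    have "0 < r * cross2 (w (Suc i)) (w i)" using orient_w[of "Suc i"] by (simp add: r)
    then have "r < 0"
      using orient_w[of i] cross2_commute[of "w i" "w (Suc i)"] by (simp add: zero_less_mult_iff)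
    then show ?thesis using r by (intro exI[of _ "- r"]) simp
  qed
  have par: "label 0 = label k \<or> label 1 = label k" for k
    using two[of k] by (simp add: label_eq_iff)
  have alt: "label i \<noteq> label (Suc i)" for i
    using orient_w[of i] by (simp add: label_eq_iff)
  have per2: "label i = label (Suc (Suc i))" for i
    using par[of i] par[of "Suc i"] par[of "Suc (Suc i)"] alt[of i] alt[of "Suc i"] by auto
  have opp': "\<exists>r>0. w (Suc (Suc i)) = - r *\<^sub>R w i" for i
    using opp per2 by (simp add: label_eq_iff)
  have pos: "\<exists>r>0. w (Suc (Suc (Suc (Suc i)))) = r *\<^sub>R w i" for i
  proof -
    obtain r s where "r > 0" "w (Suc (Suc i)) = - r *\<^sub>R w i" "s > 0"
      "w (Suc (Suc (Suc (Suc i)))) = - s *\<^sub>R w (Suc (Suc i))"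
      using opp'[of i] opp'[of "Suc (Suc i)"] by blast
    then show ?thesis by (intro exI[of _ "s * r"]) simp
  qed
  obtain r s where rs: "r > 0" "s > 0" "w 4 = r *\<^sub>R w 0" "w 5 = s *\<^sub>R w 1"
    using pos[of 0] pos[of 1] by (auto simp: eval_nat_numeral)
  \<comment> \<open>Both cells span the same cone, so they overlap along its middle
    direction.\<close>
  have "cell 0 = cell 4"
    by (rule overlap_imp_eq[of _ _ "w 0 + w 1"])
       (use rs orient_w[of 0] in \<open>simp_all add: en_cell eval_nat_numeral flip: w_def\<close>)
  then have c4: "cell 4 = cell 0" ..
  have "period = 4"
  proof -
    have "period \<le> 4" unfolding period_def using c4 by (intro Least_le) simp
    \<comment> \<open>An odd period contradicts the alternation of labels.\<close>
    moreover have "period \<noteq> 3"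
    proof
      assume "period = 3"
      then have "w 3 = w 0" using w_period by simp
      then show False using per2[of 1] label_0_neq_1 by (simp add: label_def eval_nat_numeral)
    qed
    ultimately show ?thesis using n by simp
  qed
  then have lt: "{..<period} = {0, 1, 2, 3}" by auto
  have dist: "distinct [cell 0, cell 1, cell 2, cell 3]"
    using inj_on_cell unfolding lt by (auto simp: inj_on_def)
  have \<Delta>: "\<Delta> = {cell 0, cell 1, cell 2, cell 3}" using cells_image unfolding lt by auto
  have mod4: "\<exists>j\<in>{0,1,2,3}. cell i = cell j \<and> cell (Suc i) = cell (Suc j)" for i
    using cell_mod[of i] period(1) lt cell_Suc by (metis lessThan_iff mod_less_divisor)
  have "dual_edges \<Delta> = {{cell 0, cell 1}, {cell 1, cell 2}, {cell 2, cell 3}, {cell 3, cell 0}}"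
  proof -
    have "dual_edges \<Delta> = (\<lambda>i. {cell i, cell (Suc i)}) ` {0, 1, 2, 3}"
    proof
      show "dual_edges \<Delta> \<subseteq> (\<lambda>i. {cell i, cell (Suc i)}) ` {0, 1, 2, 3}"
      proof
        fix e assume "e \<in> dual_edges \<Delta>"
        then obtain i where "e = {cell i, cell (Suc i)}" unfolding dual_edges_eq by blast
        moreover obtain j where "j \<in> {0, 1, 2, 3}" "cell i = cell j" "cell (Suc i) = cell (Suc j)"
          using mod4 by metis
        ultimately have "e = (\<lambda>i. {cell i, cell (Suc i)}) j" "j \<in> {0, 1, 2, 3}" by simp_all
        then show "e \<in> (\<lambda>i. {cell i, cell (Suc i)}) ` {0, 1, 2, 3}" by (rule image_eqI)
      qed
    qed (auto simp: dual_edges_eq)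
    then show ?thesis using c4 by (simp add: eval_nat_numeral)
  qed
  moreover have "range label = {label 0, label 1}" using par by auto
  then have "card (edge_label ` dual_edges \<Delta>) = 2" using label_0_neq_1 by (simp add: labels_eq)
  ultimately show ?thesis using dist \<Delta> unfolding has_singular_vertex_def by blast
qed

end

lemma pinwheel_triangle_fan:
  assumes "pinwheel_triangulation \<Delta>"
  obtains v st en where "triangle_fan \<Delta> v st en"
proof -
  obtain v where v: "interior_vertices \<Delta> = {v}" "\<forall>T\<in>\<Delta>. v extreme_point_of T"
    and tri: "triangulation \<Delta>" "\<forall>T\<in>\<Delta>. (2::int) simplex T"
    using assms unfolding pinwheel_triangulation_def by blast
  have "\<forall>T\<in>\<Delta>. \<exists>ab. T = triangle v (fst ab) (snd ab) \<and> cross2 (fst ab) (snd ab) > 0"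
    using simplex2_triangleE v(2) tri(2) by (metis fst_conv snd_conv)
  then obtain f where f: "\<forall>T\<in>\<Delta>. T = triangle v (fst (f T)) (snd (f T)) \<and> cross2 (fst (f T)) (snd (f T)) > 0"
    by metis
  have "triangle_fan \<Delta> v (fst \<circ> f) (snd \<circ> f)"
  proof
    show "finite \<Delta>" using tri(1) unfolding triangulation_def by blast
    show "T \<inter> T' face_of T" if "T \<in> \<Delta>" "T' \<in> \<Delta>" for T T'
      using tri(1) that unfolding triangulation_def by blast
    show "v \<in> interior (\<Union>\<Delta>)" using v(1) unfolding interior_vertices_def by blast
  qed (use f in \<open>simp_all flip: One_nat_def\<close>)
  then show ?thesis by (rule that)
qed

section \<open>Dimensions and bivariate polynomials\<close>

context vector_space_pair
begin

text \<open>Rank-nullity inside spaces that may be infinite-dimensional; finiteness is asked of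
  \<open>V\<close> alone, through a finite spanning set. A basis \<open>B\<close> of the kernel is
  extended to \<open>B'\<close>, and \<open>f\<close> is injective on the span of the added vectors
  \<open>C\<close>.\<close>

lemma dim_image_add_dim_kernel:
  assumes f: "Vector_Spaces.linear s1 s2 f" and V: "vs1.subspace V" "V \<subseteq> vs1.span A" "finite A"
  shows "vs1.dim V = vs2.dim (f ` V) + vs1.dim {x \<in> V. f x = 0}"
proof -
  interpret f: Vector_Spaces.linear s1 s2 f by (rule f)
  let ?K = "{x \<in> V. f x = 0}"
  obtain B where B: "B \<subseteq> ?K" "vs1.independent B" "?K \<subseteq> vs1.span B"
    by (rule vs1.maximal_independent_subset)
  have "B \<subseteq> V" using B(1) by blast
  obtain B' where B': "B \<subseteq> B'" "B' \<subseteq> V" "vs1.independent B'" "V \<subseteq> vs1.span B'"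
    by (rule vs1.maximal_independent_subset_extend[OF \<open>B \<subseteq> V\<close> B(2)])
  define C where "C = B' - B"
  have fin: "finite B'" "finite C"
    using vs1.independent_span_bound[OF V(3) B'(3)] B'(2) V(2) by (auto simp: C_def)
  have indC: "vs1.independent C" using B'(3) vs1.independent_mono by (auto simp: C_def)
  have spanB': "vs1.span B' = V" using B' V(1) by (meson subset_antisym vs1.span_minimal)
  have inj: "inj_on f (vs1.span C)"
    unfolding f.inj_on_iff_eq_0[OF vs1.subspace_span]
  proof (intro ballI impI)
    fix x assume x: "x \<in> vs1.span C" "f x = 0"
    have "vs1.span C \<subseteq> V" unfolding spanB'[symmetric] by (intro vs1.span_mono) (auto simp: C_def)
    then have xB: "x \<in> vs1.span B" using x B(3) by blast
    \<comment> \<open>\<open>x\<close> lies in the spans of the disjoint parts \<open>B\<close> and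
      \<open>C\<close> of a basis, so its representation is supported in both and vanishes.\<close>
    have "vs1.representation B' x = vs1.representation B x"
      using B'(3) xB B'(1) by (rule vs1.representation_extend)
    moreover have "vs1.representation B' x = vs1.representation C x"
      by (rule vs1.representation_extend[OF B'(3) x(1)]) (simp add: C_def)
    ultimately have "vs1.representation B' x b = 0" for b
      using vs1.representation_ne_zero[of B x b] vs1.representation_ne_zero[of C x b]
      by (auto simp: C_def)
    moreover have "x \<in> vs1.span B'" using xB B'(1) vs1.span_mono by blast
    ultimately show "x = 0"
      using vs1.sum_representation_eq[OF B'(3) _ fin(1), of x] by simp
  qed
  have "f ` V \<subseteq> vs2.span (f ` C)"
  proof -
    have "f ` B' \<subseteq> insert 0 (f ` C)" using B(1) by (auto simp: C_def)
    then have "vs2.span (f ` B') \<subseteq> vs2.span (f ` C)"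
      using vs2.span_mono[of "f ` B'" "insert 0 (f ` C)"] by simp
    then show ?thesis using f.span_image[of B'] spanB' by simp
  qed
  moreover have "f ` C \<subseteq> f ` V" using B'(2) by (auto simp: C_def)
  moreover have "vs2.independent (f ` C)" by (rule f.independent_injective_image[OF indC inj])
  ultimately have "vs2.dim (f ` V) = card (f ` C)" by (metis vs2.basis_card_eq_dim)
  also have "\<dots> = card C" using inj vs1.span_superset by (intro card_image) (rule inj_on_subset)
  finally have "vs2.dim (f ` V) = card C" .
  moreover have "vs1.dim V = card B'" using B' by (metis vs1.basis_card_eq_dim)
  moreover have "vs1.dim ?K = card B" using B by (metis vs1.basis_card_eq_dim)
  moreover have "card B' = card C + card B"
    unfolding C_def using fin B'(1) by (simp add: card_Diff_subset finite_subset card_mono)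
  ultimately show ?thesis by simp
qed

lemma dim_injective_image:
  assumes "Vector_Spaces.linear s1 s2 f" "vs1.subspace V" "V \<subseteq> vs1.span A" "finite A"
    and "\<And>x. x \<in> V \<Longrightarrow> f x = 0 \<Longrightarrow> x = 0"
  shows "vs2.dim (f ` V) = vs1.dim V"
proof -
  have "{x \<in> V. f x = 0} = {0}"
    using assms(5) vs1.subspace_0[OF assms(2)] linear_0[OF assms(1)] by blast
  moreover have "vs1.dim {0} = 0"
    using vs1.dim_span_eq_card_independent[OF vs1.independent_empty] by simp
  ultimately show ?thesis using dim_image_add_dim_kernel[OF assms(1-4)] by simp
qed

end

section \<open>Coefficient spaces and linear combinations\<close>

definition coeff_scale :: "real \<Rightarrow> ('a \<Rightarrow> real) \<Rightarrow> 'a \<Rightarrow> real" where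
  "coeff_scale r c = (\<lambda>a. r * c a)"

interpretation coeff: vector_space "coeff_scale :: real \<Rightarrow> ('a \<Rightarrow> real) \<Rightarrow> 'a \<Rightarrow> real"
  by unfold_locales (auto simp: coeff_scale_def fun_eq_iff algebra_simps)

interpretation coeff_fun: vector_space_pair "coeff_scale :: real \<Rightarrow> ('a \<Rightarrow> real) \<Rightarrow> 'a \<Rightarrow> real" scale_fun
  by unfold_locales

text \<open>The coordinate space over \<open>A\<close>, realized inside the functions on the whole
  index type.\<close>

definition supported :: "'a set \<Rightarrow> ('a \<Rightarrow> real) set" where
  "supported A = {c. \<forall>a. a \<notin> A \<longrightarrow> c a = 0}"

lemma sum_fun_apply: "(\<Sum>a\<in>A. f a) x = (\<Sum>a\<in>A. f a x)"
  for f :: "'a \<Rightarrow> 'b \<Rightarrow> real"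
  by (induction A rule: infinite_finite_induct) auto

lemma subspace_supported: "coeff.subspace (supported A)"
  by (intro coeff.subspaceI) (auto simp: supported_def coeff_scale_def)

lemma
  assumes "finite A"
  shows supported_subset_span: "supported A \<subseteq> coeff.span ((\<lambda>a. indicat_real {a}) ` A)"
    and dim_supported: "coeff.dim (supported A) = card A"
proof -
  let ?B = "(\<lambda>a. indicat_real {a}) ` A"
  have inj: "inj_on (\<lambda>a. indicat_real {a}) A"
    by (auto simp: inj_on_def fun_eq_iff indicator_def split: if_splits)
  show span: "supported A \<subseteq> coeff.span ?B"
  proof
    fix c assume "c \<in> supported A"
    then have "c x = (\<Sum>a\<in>A. coeff_scale (c a) (indicat_real {a})) x" for x
      using assms by (cases "x \<in> A")
        (simp_all add: sum_fun_apply coeff_scale_def indicator_def supported_def Int_insert_right)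
    then have "c = (\<Sum>a\<in>A. coeff_scale (c a) (indicat_real {a}))" ..
    moreover have "(\<Sum>a\<in>A. coeff_scale (c a) (indicat_real {a})) \<in> coeff.span ?B"
      by (intro coeff.span_sum coeff.span_scale coeff.span_base) auto
    ultimately show "c \<in> coeff.span ?B" by simp
  qed
  have "coeff.independent ?B"
  proof (rule coeff.independent_if_scalars_zero)
    fix f x assume *: "(\<Sum>x\<in>?B. coeff_scale (f x) x) = 0" "x \<in> ?B"
    then obtain a where a: "a \<in> A" "x = indicat_real {a}" by blast
    have "0 = (\<Sum>x\<in>?B. coeff_scale (f x) x) a" using *(1) by simp
    also have "\<dots> = (\<Sum>b\<in>A. f (indicat_real {b}) * indicat_real {b} a)"
      by (simp add: sum.reindex[OF inj] sum_fun_apply coeff_scale_def)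
    also have "\<dots> = f x" using a assms by (simp add: indicator_def)
    finally show "f x = 0" by simp
  qed (use assms in simp)
  moreover have "?B \<subseteq> supported A" by (auto simp: supported_def indicator_def)
  ultimately show "coeff.dim (supported A) = card A"
    using coeff.basis_card_eq_dim[of ?B] span card_image[OF inj] by simp
qed

definition combination :: "('a \<Rightarrow> real^2 \<Rightarrow> real) \<Rightarrow> 'a set \<Rightarrow> ('a \<Rightarrow> real) \<Rightarrow> real^2 \<Rightarrow> real" where
  "combination g A c = (\<lambda>p. \<Sum>a\<in>A. c a * g a p)"

lemma linear_combination: "Vector_Spaces.linear coeff_scale scale_fun (combination g A)"
  unfolding Vector_Spaces.linear_iff
  by (auto simp: combination_def coeff_scale_def scale_fun_def fun_eq_iff
      sum.distrib sum_distrib_left algebra_simps intro: coeff.vector_space_axioms fun_vs.vector_space_axioms)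

lemma combination_in_span:
  assumes "B \<subseteq> A"
  shows "combination g B c \<in> fun_vs.span (g ` A)"
proof -
  have "combination g B c = (\<Sum>a\<in>B. scale_fun (c a) (g a))"
    by (simp add: combination_def scale_fun_def fun_eq_iff sum_fun_apply)
  also have "\<dots> \<in> fun_vs.span (g ` A)"
    using assms by (intro fun_vs.span_sum fun_vs.span_scale fun_vs.span_base) auto
  finally show ?thesis .
qed

lemma in_span_combinationE:
  assumes "finite A" "P \<in> fun_vs.span (g ` A)"
  obtains c where "c \<in> supported A" "P = combination g A c"
proof -
  have "\<exists>c. c \<in> supported A \<and> P = combination g A c"
    using assms(2)
  proof (induction rule: fun_vs.span_induct_alt)
    case base
    show ?case by (intro exI[of _ "\<lambda>a. 0"]) (simp add: supported_def combination_def fun_eq_iff)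
  next
    case (step r h Q)
    then obtain c a where c: "c \<in> supported A" "Q = combination g A c" and a: "a \<in> A" "h = g a"
      by blast
    have "scale_fun r h + Q = combination g A (\<lambda>b. (if b = a then r else 0) + c b)"
      using assms(1) a c
      by (simp add: combination_def scale_fun_def fun_eq_iff distrib_right sum.distrib
          if_distrib[of "\<lambda>u. u * _"] cong: if_cong)
    moreover have "(\<lambda>b. (if b = a then r else 0) + c b) \<in> supported A"
      using a c by (auto simp: supported_def)
    ultimately show ?case by blast
  qed
  then show ?thesis using that by blast
qed

lemma span_eq_combination_image:
  assumes "finite A"
  shows "fun_vs.span (g ` A) = combination g A ` supported A"
  using in_span_combinationE[OF assms] combination_in_span[of A A g]
  by (metis (no_types, lifting) image_iff order_refl subsetI subset_antisym)

lemma combination_cong: "(\<And>a. a \<in> A \<Longrightarrow> c a = c' a) \<Longrightarrow> combination g A c = combination g A c'"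
  by (simp add: combination_def)

section \<open>Polynomial spaces and affine coordinate changes\<close>

definition monomial :: "(real^2 \<Rightarrow> real) \<Rightarrow> (real^2 \<Rightarrow> real) \<Rightarrow> nat \<times> nat \<Rightarrow> real^2 \<Rightarrow> real" where
  "monomial x y = (\<lambda>(i, j) p. x p ^ i * y p ^ j)"

definition degrees :: "nat \<Rightarrow> nat \<Rightarrow> (nat \<times> nat) set" where
  "degrees k d = {(i, j). i + j + k \<le> d}"

text \<open>Bounding the degree by \<open>d\<close> after multiplication by a form of degree \<open>k\<close>, instead of
  by \<open>d - k\<close>, makes the space trivial when \<open>d < k\<close>.\<close>

definition poly_space :: "(real^2 \<Rightarrow> real) \<Rightarrow> (real^2 \<Rightarrow> real) \<Rightarrow> nat \<Rightarrow> nat \<Rightarrow> (real^2 \<Rightarrow> real) set" where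
  "poly_space x y k d = fun_vs.span (monomial x y ` degrees k d)"

abbreviation polys :: "nat \<Rightarrow> nat \<Rightarrow> (real^2 \<Rightarrow> real) set" where
  "polys \<equiv> poly_space (\<lambda>p. p $ 1) (\<lambda>p. p $ 2)"

lemma finite_degrees [simp]: "finite (degrees k d)"
  by (rule finite_subset[of _ "{..d} \<times> {..d}"]) (auto simp: degrees_def)

lemma polynomial_le_iff: "polynomial_le d P \<longleftrightarrow> P \<in> polys 0 d"
proof
  assume "polynomial_le d P"
  then obtain c where c: "\<And>p. P p = (\<Sum>(i, j)\<in>{(i, j). i + j \<le> d}. c i j * (p $ 1) ^ i * (p $ 2) ^ j)"
    unfolding polynomial_le_def by blast
  have "P = combination (monomial (\<lambda>p. p $ 1) (\<lambda>p. p $ 2)) (degrees 0 d) (\<lambda>(i, j). c i j)"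
    by (auto simp: combination_def monomial_def degrees_def c fun_eq_iff case_prod_unfold mult.assoc)
  then show "P \<in> polys 0 d" unfolding poly_space_def using combination_in_span[OF order_refl] by simp
next
  assume "P \<in> polys 0 d"
  then obtain c where "P = combination (monomial (\<lambda>p. p $ 1) (\<lambda>p. p $ 2)) (degrees 0 d) c"
    unfolding poly_space_def by (rule in_span_combinationE[OF finite_degrees])
  then show "polynomial_le d P" unfolding polynomial_le_def
    by (intro exI[of _ "\<lambda>i j. c (i, j)"])
       (auto simp: combination_def monomial_def degrees_def case_prod_unfold mult.assoc)
qed

lemma subspace_poly_space: "fun_vs.subspace (poly_space x y k d)"
  by (simp add: poly_space_def)

lemma poly_space_add: "P \<in> poly_space x y k d \<Longrightarrow> Q \<in> poly_space x y k d \<Longrightarrow> (\<lambda>p. P p + Q p) \<in> poly_space x y k d"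
  using fun_vs.subspace_add[OF subspace_poly_space, of P x y k d Q] by (simp add: plus_fun_def)

lemma poly_space_scale: "P \<in> poly_space x y k d \<Longrightarrow> (\<lambda>p. r * P p) \<in> poly_space x y k d"
  using fun_vs.subspace_scale[OF subspace_poly_space, of P x y k d r] by (simp add: scale_fun_def)

lemma poly_space_diff: "P \<in> poly_space x y k d \<Longrightarrow> Q \<in> poly_space x y k d \<Longrightarrow> (\<lambda>p. P p - Q p) \<in> poly_space x y k d"
  using fun_vs.subspace_diff[OF subspace_poly_space, of P x y k d Q] by (simp add: fun_diff_def)

lemma poly_space_induct [consumes 1, case_names zero add]:
  assumes "P \<in> poly_space x y k d"
    and "Pr (\<lambda>p. 0)"
    and "\<And>i j r Q. i + j + k \<le> d \<Longrightarrow> Q \<in> poly_space x y k d \<Longrightarrow> Pr Q \<Longrightarrow> Pr (\<lambda>p. r * (x p ^ i * y p ^ j) + Q p)"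
  shows "Pr P"
proof -
  have "P \<in> poly_space x y k d \<and> Pr P"
    using assms(1) unfolding poly_space_def
  proof (induction rule: fun_vs.span_induct_alt)
    case base
    then show ?case using assms(2) fun_vs.span_zero by (simp add: zero_fun_def)
  next
    case (step r h Q)
    then obtain i j where h: "h = (\<lambda>p. x p ^ i * y p ^ j)" "i + j + k \<le> d"
      by (auto simp: monomial_def degrees_def)
    have "Pr (\<lambda>p. r * (x p ^ i * y p ^ j) + Q p)"
      using step h assms(3)[of i j Q r] by (simp add: poly_space_def)
    then have "Pr (scale_fun r h + Q)" unfolding h(1) scale_fun_def plus_fun_def .
    moreover have "scale_fun r h + Q \<in> fun_vs.span (monomial x y ` degrees k d)"
      using fun_vs.span_add[OF fun_vs.span_scale[OF fun_vs.span_base[OF step(1)]]] step.IH by blast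
    ultimately show ?case unfolding plus_fun_def by blast
  qed
  then show ?thesis ..
qed

lemma monomial_in_poly_space: "i + j + k \<le> d \<Longrightarrow> (\<lambda>p. x p ^ i * y p ^ j) \<in> poly_space x y k d"
  unfolding poly_space_def by (rule fun_vs.span_base) (auto simp: monomial_def degrees_def image_iff)

lemma poly_space_mult_affine:
  assumes "P \<in> poly_space x y (Suc k) d"
  shows "(\<lambda>p. (\<alpha> * x p + \<beta> * y p + \<gamma>) * P p) \<in> poly_space x y k d"
  using assms
proof (induction rule: poly_space_induct)
  case zero
  then show ?case using fun_vs.subspace_0[OF subspace_poly_space] by (simp add: zero_fun_def)
next
  case (add i j r Q)
  have "(\<lambda>p. x p ^ Suc i * y p ^ j) \<in> poly_space x y k d"
    "(\<lambda>p. x p ^ i * y p ^ Suc j) \<in> poly_space x y k d"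
    "(\<lambda>p. x p ^ i * y p ^ j) \<in> poly_space x y k d"
    using add(1) by (intro monomial_in_poly_space; simp)+
  then have "(\<lambda>p. (r * \<alpha>) * (x p ^ Suc i * y p ^ j) + (r * \<beta>) * (x p ^ i * y p ^ Suc j) +
      (r * \<gamma>) * (x p ^ i * y p ^ j) + (\<alpha> * x p + \<beta> * y p + \<gamma>) * Q p) \<in> poly_space x y k d"
    using add.IH by (intro poly_space_add poly_space_scale)
  then show ?case by (simp add: algebra_simps)
qed

text \<open>A product of powers of \<open>x'\<close> and \<open>y'\<close> is built one factor at a
  time. Each factor uses up one unit of \<open>k\<close>, which is why \<open>k\<close> varies in
  the inductions.\<close>

lemma poly_space_affine_subset:
  assumes "\<And>p. x' p = \<alpha> * x p + \<beta> * y p + \<gamma>" "\<And>p. y' p = \<alpha>' * x p + \<beta>' * y p + \<gamma>'"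
  shows "poly_space x' y' k d \<subseteq> poly_space x y k d"
proof -
  have "(\<lambda>p. x' p ^ i * y' p ^ j) \<in> poly_space x y k d" if "i + j + k \<le> d" for i j
    using that
  proof (induction i arbitrary: k)
    case 0
    then show ?case
    proof (induction j arbitrary: k)
      case 0
      then show ?case using monomial_in_poly_space[of 0 0 k d x y] by simp
    next
      case (Suc j)
      then show ?case
        using poly_space_mult_affine[of "\<lambda>p. y' p ^ j" x y k d \<alpha>' \<beta>' \<gamma>'] by (simp add: assms(2))
    qed
  next
    case (Suc i)
    then have "(\<lambda>p. x' p ^ i * y' p ^ j) \<in> poly_space x y (Suc k) d" by simp
    from poly_space_mult_affine[OF this, of \<alpha> \<beta> \<gamma>] show ?case
      by (simp add: assms(1) mult.assoc)
  qed
  then have "monomial x' y' ` degrees k d \<subseteq> poly_space x y k d"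
    by (auto simp: monomial_def degrees_def)
  then show ?thesis unfolding poly_space_def[of x' y'] by (intro fun_vs.span_minimal subspace_poly_space)
qed

definition edge_form :: "real^2 \<Rightarrow> real^2 \<Rightarrow> real^2 \<Rightarrow> real" where
  "edge_form v a p = cross2 a (p - v)"

text \<open>Forms of two independent directions are affine coordinates of the plane; Cramer's rule
  gives the inverse substitution.\<close>

lemma poly_space_edge_forms:
  assumes "cross2 a b \<noteq> 0"
  shows "poly_space (edge_form v a) (edge_form v b) k d = polys k d"
proof
  show "poly_space (edge_form v a) (edge_form v b) k d \<subseteq> polys k d"
    by (rule poly_space_affine_subset[where \<alpha> = "- a $ 2" and \<beta> = "a $ 1" and \<gamma> = "a $ 2 * v $ 1 - a $ 1 * v $ 2"
          and \<alpha>' = "- b $ 2" and \<beta>' = "b $ 1" and \<gamma>' = "b $ 2 * v $ 1 - b $ 1 * v $ 2"])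
       (simp_all add: edge_form_def cross2_def algebra_simps)
  have "p $ i = (b $ i / cross2 a b) * edge_form v a p + (- a $ i / cross2 a b) * edge_form v b p + v $ i" for p i
  proof -
    have "(p - v) $ i = ((cross2 (p - v) b / cross2 a b) *\<^sub>R a + (cross2 a (p - v) / cross2 a b) *\<^sub>R b) $ i"
      using cross2_expand[OF assms] by metis
    then show ?thesis
      unfolding edge_form_def cross2_commute[of "p - v" b]
      by (simp add: algebra_simps add_divide_distrib diff_divide_distrib)
  qed
  then show "polys k d \<subseteq> poly_space (edge_form v a) (edge_form v b) k d"
    by (intro poly_space_affine_subset)
qed

lemma real_polynomial_function_poly_space:
  assumes "real_polynomial_function x" "real_polynomial_function y" "P \<in> poly_space x y k d"
  shows "real_polynomial_function P"
  using assms(3) by (induction rule: poly_space_induct)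
    (auto intro!: real_polynomial_function.intros(2-) real_polynomial_function_power assms)

lemma real_polynomial_function_nth: "real_polynomial_function (\<lambda>p::real^2. p $ i)"
  by (intro real_polynomial_function.intros(1) bounded_linear_vec_nth)

lemma real_polynomial_function_polys: "P \<in> polys k d \<Longrightarrow> real_polynomial_function P"
  by (rule real_polynomial_function_poly_space) (rule real_polynomial_function_nth)+

lemma real_polynomial_function_edge_form: "real_polynomial_function (edge_form v a)"
  unfolding edge_form_def cross2_def vector_minus_component
  by (intro real_polynomial_function_diff real_polynomial_function.intros(2,4)
      real_polynomial_function_nth)

section \<open>Identity theorems for polynomials\<close>

lemma infinite_zeros_imp_coeffs_zero:
  fixes c :: "nat \<Rightarrow> real"
  assumes "infinite S" "\<And>t. t \<in> S \<Longrightarrow> (\<Sum>i\<le>n. c i * t ^ i) = 0" "i \<le> n"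
  shows "c i = 0"
proof (rule ccontr)
  assume "c i \<noteq> 0"
  then have "finite {t. (\<Sum>i\<le>n. c i * t ^ i) = 0}"
    using assms(3) polyfun_finite_roots[of c n] by blast
  moreover have "S \<subseteq> {t. (\<Sum>i\<le>n. c i * t ^ i) = 0}" using assms(2) by blast
  ultimately show False using assms(1) finite_subset by blast
qed

text \<open>On the line through \<open>q\<close> and \<open>p\<close> the function is a univariate
  polynomial that vanishes on an interval.\<close>

lemma real_polynomial_function_zero_on_open:
  fixes P :: "real^2 \<Rightarrow> real"
  assumes P: "real_polynomial_function P" and U: "open U" "q \<in> U" "\<And>p. p \<in> U \<Longrightarrow> P p = 0"
  shows "P p = 0"
proof -
  define u where "u = p - q"
  have "polynomial_function (\<lambda>t::real. q + t *\<^sub>R u)"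
    unfolding polynomial_function_def
  proof (intro allI impI)
    fix f :: "real^2 \<Rightarrow> real" assume "bounded_linear f"
    then have "f \<circ> (\<lambda>t::real. q + t *\<^sub>R u) = (\<lambda>t. f q + t * f u)"
      by (simp add: fun_eq_iff linear_simps)
    then show "real_polynomial_function (f \<circ> (\<lambda>t::real. q + t *\<^sub>R u))"
      by (simp add: real_polynomial_function.intros(2-4) real_polynomial_function.intros(1)[OF bounded_linear_ident])
  qed
  then have "real_polynomial_function (P \<circ> (\<lambda>t::real. q + t *\<^sub>R u))"
    using P by (rule real_polynomial_function_compose)
  then obtain c n where c: "P (q + t *\<^sub>R u) = (\<Sum>i\<le>n. c i * t ^ i)" for t
    unfolding real_polynomial_function_iff_sum by (auto simp: o_def fun_eq_iff)
  obtain e where e: "0 < e" "ball q e \<subseteq> U" using U(1,2) by (meson open_contains_ball)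
  define r where "r = e / (1 + norm u)"
  have r: "0 < r" using e by (simp add: r_def add_pos_nonneg)
  have "(\<Sum>i\<le>n. c i * t ^ i) = 0" if "t \<in> {0<..<r}" for t
  proof -
    have "t * norm u \<le> t * (1 + norm u)" using that by (intro mult_left_mono) auto
    also have "\<dots> < r * (1 + norm u)" using that by (intro mult_strict_right_mono) (auto simp: add_pos_nonneg)
    also have "\<dots> = e" using norm_ge_zero[of u] by (simp add: r_def del: norm_ge_zero)
    finally have "q + t *\<^sub>R u \<in> ball q e" using that by (simp add: dist_norm)
    then show ?thesis using e(2) U(3) c[of t] by auto
  qed
  then have "c i = 0" if "i \<le> n" for i
    using infinite_zeros_imp_coeffs_zero[of "{0<..<r}" c n i] that r by (simp add: infinite_Ioo)
  then show ?thesis using c[of 1] by (simp add: u_def)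
qed

text \<open>Read as a polynomial in the value of \<open>x\<close> whose coefficients are polynomials
  in the value of \<open>y\<close>; the univariate statement is applied twice.\<close>

lemma combination_monomial_eq_0:
  assumes surj: "\<And>s t. \<exists>p. x p = s \<and> y p = t" and I: "finite I"
    and zero: "\<And>p. combination (monomial x y) I c p = 0" and "a \<in> I"
  shows "c a = 0"
proof -
  obtain n where n: "I \<subseteq> {..n} \<times> {..n}"
  proof
    show "I \<subseteq> {..Max (fst ` I \<union> snd ` I)} \<times> {..Max (fst ` I \<union> snd ` I)}"
      using I by (force intro: Max_ge)
  qed
  \<comment> \<open>Padding by zero to a square of exponents, so that the double sum can be
    iterated.\<close>
  define c' where "c' i j = (if (i, j) \<in> I then c (i, j) else 0)" for i j
  have "(\<Sum>i\<le>n. (\<Sum>j\<le>n. c' i j * t ^ j) * s ^ i) = 0" for s t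
  proof -
    obtain p where p: "x p = s" "y p = t" using surj by blast
    have "0 = (\<Sum>(i, j)\<in>I. c (i, j) * (s ^ i * t ^ j))"
      using zero[of p] by (simp add: combination_def monomial_def case_prod_unfold p)
    also have "\<dots> = (\<Sum>(i, j)\<in>{..n} \<times> {..n}. c' i j * (s ^ i * t ^ j))"
      using n by (intro sum.mono_neutral_cong_left) (auto simp: c'_def)
    also have "\<dots> = (\<Sum>i\<le>n. (\<Sum>j\<le>n. c' i j * t ^ j) * s ^ i)"
      by (simp add: sum.cartesian_product[symmetric] sum_distrib_right sum_distrib_left mult_ac)
    finally show ?thesis by simp
  qed
  then have "(\<Sum>j\<le>n. c' i j * t ^ j) = 0" if "i \<le> n" for i t
    using that polyfun_eq_0[of "\<lambda>i. \<Sum>j\<le>n. c' i j * t ^ j" n] by blast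
  then have "c' i j = 0" if "i \<le> n" "j \<le> n" for i j
    using that polyfun_eq_0[of "c' i" n] by blast
  moreover obtain i j where a: "a = (i, j)" by fastforce
  ultimately have "c' i j = 0" using n \<open>a \<in> I\<close> by blast
  then show ?thesis using \<open>a \<in> I\<close> by (simp add: c'_def a)
qed

lemma edge_forms_surj:
  assumes "cross2 a b \<noteq> 0"
  shows "\<exists>p. edge_form v a p = s \<and> edge_form v b p = t"
proof -
  define q where "q = (s / cross2 a b) *\<^sub>R b - (t / cross2 a b) *\<^sub>R a"
  have "cross2 a q = s" "cross2 b q = t"
    using assms cross2_commute[of b a] by (simp_all add: q_def)
  then show ?thesis unfolding edge_form_def by (intro exI[of _ "v + q"]) (simp del: cross2_linear)
qed

lemma dim_span_monomials:
  assumes surj: "\<And>s t. \<exists>p. x p = s \<and> y p = t" and I: "finite I"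
  shows "fun_vs.dim (fun_vs.span (monomial x y ` I)) = card I"
  unfolding span_eq_combination_image[OF I] dim_supported[OF I, symmetric]
proof (rule coeff_fun.dim_injective_image[OF linear_combination subspace_supported supported_subset_span[OF I]])
  fix c assume "c \<in> supported I" "combination (monomial x y) I c = 0"
  then have "c a = 0" for a
    using combination_monomial_eq_0[OF surj I, of c a] by (cases "a \<in> I") (auto simp: supported_def simp del: split_paired_All)
  then show "c = 0" by (simp add: fun_eq_iff)
qed (use I in simp)

section \<open>Differentiability and division by the square of an edge form\<close>

lemma C1_on_const: "C1_on S (\<lambda>p. c)"
  unfolding C1_on_def by (rule exI[of _ "\<lambda>p. 0"]) (auto simp: zero_blinfun.rep_eq)

lemma C1_on_linear:
  assumes "bounded_linear f"
  shows "C1_on S f"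
  unfolding C1_on_def
  by (rule exI[of _ "\<lambda>p. Blinfun f"])
     (auto simp: bounded_linear_Blinfun_apply[OF assms] bounded_linear_imp_has_derivative[OF assms])

lemma C1_on_mult:
  assumes "C1_on S f" "C1_on S g"
  shows "C1_on S (\<lambda>p. f p * g p)"
proof -
  obtain f' g' :: "real^2 \<Rightarrow> ((real^2) \<Rightarrow>\<^sub>L real)" where
    f: "\<And>p. p \<in> S \<Longrightarrow> (f has_derivative blinfun_apply (f' p)) (at p within S)" "continuous_on S f'" and
    g: "\<And>p. p \<in> S \<Longrightarrow> (g has_derivative blinfun_apply (g' p)) (at p within S)" "continuous_on S g'"
    using assms unfolding C1_on_def by blast
  have "continuous_on S f" "continuous_on S g"
    using f(1) g(1) by (meson has_derivative_continuous_on)+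
  then show ?thesis
    unfolding C1_on_def
    by (intro exI[of _ "\<lambda>p. f p *\<^sub>R g' p + g p *\<^sub>R f' p"] conjI ballI continuous_intros f g)
       (auto simp: plus_blinfun.rep_eq scaleR_blinfun.rep_eq mult.commute intro!: derivative_eq_intros f g)
qed

lemma real_polynomial_function_C1: "real_polynomial_function P \<Longrightarrow> C1_on S P"
  by (induction rule: real_polynomial_function.induct)
     (simp_all add: C1_on_const C1_on_linear C1_on_add C1_on_mult)

text \<open>Division by the square of \<open>x\<close> with remainder: monomials are sorted by
  exponent 0, 1, or at least 2 of \<open>x\<close>.\<close>

lemma poly_space_decompose:
  assumes "P \<in> poly_space x y 0 d"
  shows "\<exists>\<alpha> \<beta> R. R \<in> poly_space x y 2 d \<and> (\<forall>p. P p =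
    (\<Sum>j\<le>d. \<alpha> j * y p ^ j) + x p * (\<Sum>j\<le>d. \<beta> j * y p ^ j) + (x p)\<^sup>2 * R p)"
  using assms
proof (induction rule: poly_space_induct)
  case zero
  have "(\<lambda>p. 0) \<in> poly_space x y 2 d"
    using fun_vs.subspace_0[OF subspace_poly_space] by (simp add: zero_fun_def)
  then show ?case by (intro exI[of _ "\<lambda>j. 0"] exI[of _ "\<lambda>p. 0"]) simp
next
  case (add i j r Q)
  then obtain \<alpha> \<beta> R where R: "R \<in> poly_space x y 2 d"
    and Q: "\<And>p. Q p = (\<Sum>j\<le>d. \<alpha> j * y p ^ j) + x p * (\<Sum>j\<le>d. \<beta> j * y p ^ j) + (x p)\<^sup>2 * R p"
    by blast
  have delta: "(\<Sum>l\<le>d. (c l + (if l = j then r else 0)) * z ^ l) = (\<Sum>l\<le>d. c l * z ^ l) + r * z ^ j"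
    for c :: "nat \<Rightarrow> real" and z
    using add(1) by (simp add: distrib_right sum.distrib if_distrib[of "\<lambda>u. u * _"] cong: if_cong)
  consider "i = 0" | "i = 1" | m where "i = m + 2"
    by (metis One_nat_def add_2_eq_Suc' not0_implies_Suc)
  then show ?case
  proof cases
    case 1
    show ?thesis
      by (rule exI[of _ "\<lambda>l. \<alpha> l + (if l = j then r else 0)"], rule exI[of _ \<beta>], rule exI[of _ R])
         (simp add: 1 delta R Q del: sum.delta sum.delta')
  next
    case 2
    show ?thesis
      by (rule exI[of _ \<alpha>], rule exI[of _ "\<lambda>l. \<beta> l + (if l = j then r else 0)"], rule exI[of _ R])
         (simp add: 2 delta R Q del: sum.delta sum.delta', simp add: algebra_simps)
  next
    case 3
    then have "(\<lambda>p. r * (x p ^ m * y p ^ j) + R p) \<in> poly_space x y 2 d"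
      using add(1) R by (intro poly_space_add poly_space_scale monomial_in_poly_space) auto
    then have "(\<lambda>p. r * (x p ^ m * y p ^ j) + R p) \<in> poly_space x y 2 d \<and> (\<forall>p. r * (x p ^ i * y p ^ j) + Q p =
        (\<Sum>j\<le>d. \<alpha> j * y p ^ j) + x p * (\<Sum>j\<le>d. \<beta> j * y p ^ j) + (x p)\<^sup>2 * (r * (x p ^ m * y p ^ j) + R p))"
      by (simp add: 3 Q algebra_simps power_add power2_eq_square)
    then show ?thesis by blast
  qed
qed

lemma edge_form_add: "edge_form v a (p + q) = edge_form v a p + cross2 a q"
  by (simp add: edge_form_def)

lemma differentiable_on_line:
  assumes "real_polynomial_function (R :: real^2 \<Rightarrow> real)"
  shows "\<exists>D. ((\<lambda>s. R (p + s *\<^sub>R u)) has_real_derivative D) (at s)"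
proof -
  obtain R' where "(R has_derivative R') (at (p + s *\<^sub>R u))"
    using real_polynomial_function_C1[OF assms, of UNIV] unfolding C1_on_def by auto
  then have "((\<lambda>s. R (p + s *\<^sub>R u)) has_derivative (\<lambda>h. R' (h *\<^sub>R u))) (at s)"
    by (rule has_derivative_compose[rotated]) (auto intro!: derivative_eq_intros)
  then show ?thesis using has_derivative_imp_has_field_derivative by (metis differentiable_def real_differentiable_def)
qed

text \<open>In the decomposition by powers of the edge form of \<open>a\<close>, the values of
  \<open>D\<close> on its zero line determine the \<alpha> part and the derivative across the line
  the \<beta> part; both have infinitely many zeros.\<close>

lemma divide_by_square:
  assumes ab: "cross2 a b \<noteq> 0" and D: "D \<in> polys 0 d" and S: "infinite S"
    and vanish: "\<And>t. t \<in> S \<Longrightarrow> \<exists>p. edge_form v a p = 0 \<and> edge_form v b p = t \<and> D p = 0 \<and>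
      (D has_derivative (\<lambda>h. 0)) (at p)"
  shows "\<exists>R\<in>polys 2 d. D = (\<lambda>p. (edge_form v a p)\<^sup>2 * R p)"
proof -
  let ?x = "edge_form v a" and ?y = "edge_form v b"
  obtain \<alpha> \<beta> R where R: "R \<in> polys 2 d"
    and D_eq: "\<And>p. D p = (\<Sum>j\<le>d. \<alpha> j * ?y p ^ j) + ?x p * (\<Sum>j\<le>d. \<beta> j * ?y p ^ j) + (?x p)\<^sup>2 * R p"
    using poly_space_decompose[of D ?x ?y d] D unfolding poly_space_edge_forms[OF ab] by blast
  have "(\<Sum>j\<le>d. \<alpha> j * t ^ j) = 0" if t: "t \<in> S" for t
    using vanish[OF t] D_eq by fastforce
  then have \<alpha>: "\<alpha> j = 0" if "j \<le> d" for j
    using infinite_zeros_imp_coeffs_zero[OF S] that by blast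
  have "(\<Sum>j\<le>d. \<beta> j * t ^ j) = 0" if t: "t \<in> S" for t
  proof -
    obtain p where p: "?x p = 0" "?y p = t" "(D has_derivative (\<lambda>h. 0)) (at p)"
      using vanish[OF t] by blast
    \<comment> \<open>Along \<open>u\<close> the form \<open>?x\<close> grows with speed 1 and
      \<open>?y\<close> is constant.\<close>
    define u where "u = (1 / cross2 a b) *\<^sub>R b"
    have u: "?x (p + s *\<^sub>R u) = s" "?y (p + s *\<^sub>R u) = t" for s
      using ab p by (simp_all add: edge_form_add u_def)
    have "((\<lambda>s. D (p + s *\<^sub>R u)) has_derivative (\<lambda>h. 0)) (at 0)"
      by (rule has_derivative_compose[of "\<lambda>s. p + s *\<^sub>R u" "\<lambda>h. h *\<^sub>R u" 0 UNIV D "\<lambda>h. 0"])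
         (use p in \<open>auto intro!: derivative_eq_intros\<close>)
    then have "((\<lambda>s. D (p + s *\<^sub>R u)) has_real_derivative 0) (at 0)"
      by (rule has_derivative_imp_has_field_derivative) simp
    moreover obtain R' where R': "((\<lambda>s. R (p + s *\<^sub>R u)) has_real_derivative R') (at 0)"
      using differentiable_on_line[OF real_polynomial_function_polys[OF R]] by blast
    have "((\<lambda>s. s * (\<Sum>j\<le>d. \<beta> j * t ^ j) + s\<^sup>2 * R (p + s *\<^sub>R u)) has_real_derivative
        (\<Sum>j\<le>d. \<beta> j * t ^ j)) (at 0)"
      by (rule derivative_eq_intros R' refl)+ simp
    then have "((\<lambda>s. D (p + s *\<^sub>R u)) has_real_derivative (\<Sum>j\<le>d. \<beta> j * t ^ j)) (at 0)"
      by (simp add: D_eq u \<alpha>)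
    ultimately show ?thesis using DERIV_unique by blast
  qed
  then have \<beta>: "\<beta> j = 0" if "j \<le> d" for j
    using infinite_zeros_imp_coeffs_zero[OF S] that by blast
  show ?thesis using R by (intro bexI[of _ R]) (auto simp: D_eq \<alpha> \<beta> fun_eq_iff)
qed

text \<open>A closed set that misses \<open>p\<close> does not accumulate at \<open>p\<close>, so
  only the sets through \<open>p\<close> influence the limit.\<close>

lemma has_derivative_within_Union_closed:
  assumes "finite \<C>" "\<And>S. S \<in> \<C> \<Longrightarrow> closed S" "p \<in> \<Union>\<C>"
    and "\<And>S. S \<in> \<C> \<Longrightarrow> p \<in> S \<Longrightarrow> (f has_derivative D) (at p within S)"
  shows "(f has_derivative D) (at p within \<Union>\<C>)"
proof -
  let ?g = "\<lambda>y. (1 / norm (y - p)) *\<^sub>R (f y - (f p + D (y - p)))"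
  have "(?g \<longlongrightarrow> 0) (at p within \<Union>\<C>)"
    using assms(1,2,4)
  proof (induction \<C>)
    case (insert S \<C>)
    have "(?g \<longlongrightarrow> 0) (at p within S)"
    proof (cases "p \<in> S")
      case True
      then show ?thesis using insert.prems(2)[of S] unfolding has_derivative_within by blast
    next
      case False
      then have "at p within S = bot"
        using insert.prems(1)[of S] closed_limpt trivial_limit_within by blast
      then show ?thesis by simp
    qed
    then show ?case using insert by (simp add: Lim_within_Un)
  qed simp
  moreover obtain S where "S \<in> \<C>" "p \<in> S" using assms(3) by blast
  then have "bounded_linear D" using assms(4) has_derivative_bounded_linear by blast
  ultimately show ?thesis unfolding has_derivative_within by blast
qed

section \<open>First-order agreement at a point\<close>

definition agree1 :: "(real^2 \<Rightarrow> real) \<Rightarrow> (real^2 \<Rightarrow> real) \<Rightarrow> real^2 \<Rightarrow> bool" where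
  "agree1 P Q p \<longleftrightarrow> P p = Q p \<and> ((\<lambda>q. P q - Q q) has_derivative (\<lambda>h. 0)) (at p)"

lemma agree1_refl: "agree1 P P p"
  by (simp add: agree1_def)

lemma agree1_sym: "agree1 P Q p \<Longrightarrow> agree1 Q P p"
  unfolding agree1_def using has_derivative_minus[of "\<lambda>q. P q - Q q" "\<lambda>h. 0"] by auto

lemma agree1_trans: "agree1 P Q p \<Longrightarrow> agree1 Q R p \<Longrightarrow> agree1 P R p"
  unfolding agree1_def
  using has_derivative_add[of "\<lambda>q. P q - Q q" "\<lambda>h. 0" "at p" "\<lambda>q. Q q - R q" "\<lambda>h. 0"] by auto

lemma agree1_has_derivative:
  assumes "agree1 P Q p" "(P has_derivative D) (at p)" "(Q has_derivative E) (at p)"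
  shows "D = E"
proof -
  have "((\<lambda>q. P q - Q q) has_derivative (\<lambda>h. D h - E h)) (at p)"
    using assms(2,3) by (rule has_derivative_diff)
  with assms(1) have "(\<lambda>h. D h - E h) = (\<lambda>h. 0)"
    unfolding agree1_def by (metis has_derivative_unique)
  then show ?thesis by (simp add: fun_eq_iff)
qed

text \<open>By the product rule, every term of the derivative of the added part retains a factor
  \<open>l p\<close>.\<close>

lemma agree1_add_square:
  assumes "real_polynomial_function l" "real_polynomial_function R" "l p = 0"
  shows "agree1 P (\<lambda>q. P q + (l q)\<^sup>2 * R q) p"
proof -
  obtain l' R' where "(l has_derivative l') (at p)" "(R has_derivative R') (at p)"
    using real_polynomial_function_C1[OF assms(1), of UNIV] real_polynomial_function_C1[OF assms(2), of UNIV]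
    unfolding C1_on_def by auto
  then have "((\<lambda>q. P q - (P q + (l q)\<^sup>2 * R q)) has_derivative (\<lambda>h. 0)) (at p)"
    using assms(3) by (auto intro!: derivative_eq_intros)
  then show ?thesis using assms(3) by (simp add: agree1_def)
qed

section \<open>Splines as solutions of a cofactor equation\<close>

lemma edge_form_mult:
  assumes "P \<in> polys (Suc k) d"
  shows "(\<lambda>p. edge_form v a p * P p) \<in> polys k d"
proof -
  have "edge_form v a p = - a $ 2 * p $ 1 + a $ 1 * p $ 2 + (a $ 2 * v $ 1 - a $ 1 * v $ 2)" for p
    by (simp add: edge_form_def cross2_def algebra_simps)
  then show ?thesis
    using poly_space_mult_affine[OF assms, of "- a $ 2" "a $ 1" "a $ 2 * v $ 1 - a $ 1 * v $ 2"] by simp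
qed

lemma edge_form_square_mult: "P \<in> polys 2 d \<Longrightarrow> (\<lambda>p. (edge_form v a p)\<^sup>2 * P p) \<in> polys 0 d"
  using edge_form_mult[OF edge_form_mult[of P "Suc 0" d v a], of v a]
  by (simp add: power2_eq_square mult.assoc numeral_2_eq_2)

text \<open>Shaped for the three terms of the square of a binomial.\<close>

lemma span_lincomb3:
  assumes "f \<in> fun_vs.span S" "g \<in> fun_vs.span S" "h \<in> fun_vs.span S"
  shows "(\<lambda>p. a * f p + b * g p + c * h p) \<in> fun_vs.span S"
  using fun_vs.span_add[OF fun_vs.span_add[OF fun_vs.span_scale[OF assms(1), of a] fun_vs.span_scale[OF assms(2), of b]]
      fun_vs.span_scale[OF assms(3), of c]]
  by (simp add: scale_fun_def plus_fun_def)

context triangle_fan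
begin

abbreviation edge :: "nat \<Rightarrow> real^2 \<Rightarrow> real" where
  "edge i \<equiv> edge_form v (w i)"

lemma coordinates [simp]: "poly_space (edge 0) (edge (Suc 0)) k d = polys k d"
  using orient_w[of 0] by (intro poly_space_edge_forms) simp

text \<open>A spline is encoded by the polynomial on cell 0 and by the smoothing cofactors, the quotients
  by \<open>(edge k)\<^sup>2\<close> of the jumps from cell \<open>k - 1\<close> to cell \<open>k\<close>. The index \<open>(0, i, j)\<close> is a coefficient
  of the former, the index \<open>(k, i, j)\<close> with \<open>k > 0\<close> one of the \<open>k\<close>-th cofactor.\<close>

definition generator :: "nat \<times> nat \<times> nat \<Rightarrow> real^2 \<Rightarrow> real" where
  "generator = (\<lambda>(k, ij) p. (if k = 0 then 1 else (edge k p)\<^sup>2) * monomial (edge 0) (edge (Suc 0)) ij p)"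

definition cofactor_indices :: "nat \<Rightarrow> nat \<Rightarrow> (nat \<times> nat \<times> nat) set" where
  "cofactor_indices m d = {1..m} \<times> degrees 2 d"

definition indices :: "nat \<Rightarrow> nat \<Rightarrow> (nat \<times> nat \<times> nat) set" where
  "indices m d = {0} \<times> degrees 0 d \<union> cofactor_indices m d"

definition cofactor :: "nat \<Rightarrow> nat \<Rightarrow> (nat \<times> nat \<times> nat \<Rightarrow> real) \<Rightarrow> real^2 \<Rightarrow> real" where
  "cofactor d k c = combination (monomial (edge 0) (edge (Suc 0))) (degrees 2 d) (\<lambda>ij. c (k, ij))"

text \<open>The polynomial after crossing the first \<open>m\<close> edges. For
  \<open>m = period\<close> the walk is back at cell 0, and agreement with
  \<open>piece d 0 c\<close> is the closing condition.\<close>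

definition piece :: "nat \<Rightarrow> nat \<Rightarrow> (nat \<times> nat \<times> nat \<Rightarrow> real) \<Rightarrow> real^2 \<Rightarrow> real" where
  "piece d m c = combination generator (indices m d) c"

definition closing :: "nat \<Rightarrow> (nat \<times> nat \<times> nat \<Rightarrow> real) \<Rightarrow> real^2 \<Rightarrow> real" where
  "closing d c = combination generator (cofactor_indices period d) c"

text \<open>An arbitrary choice where cells meet; by \<open>spline_eq_piece\<close> it does not
  affect the spline once the closing condition holds.\<close>

definition cell_index :: "real^2 \<Rightarrow> nat" where
  "cell_index p = (LEAST i. p \<in> cell i)"

text \<open>Defined for every \<open>c\<close>, also without the closing condition, so that it is a
  linear map.\<close>

definition spline :: "nat \<Rightarrow> (nat \<times> nat \<times> nat \<Rightarrow> real) \<Rightarrow> real^2 \<Rightarrow> real" where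
  "spline d c p = (if p \<in> \<Union>\<Delta> then piece d (cell_index p) c p else 0)"

lemma finite_indices [simp]: "finite (indices m d)" "finite (cofactor_indices m d)"
  by (simp_all add: indices_def cofactor_indices_def)

lemma cofactor_in: "cofactor d k c \<in> polys 2 d"
  using combination_in_span[OF order_refl, of "monomial (edge 0) (edge (Suc 0))" "degrees 2 d"]
  unfolding cofactor_def poly_space_def[symmetric] by simp

lemma piece_0: "piece d 0 c = combination (monomial (edge 0) (edge (Suc 0))) (degrees 0 d) (\<lambda>ij. c (0, ij))"
proof
  fix p
  have "indices 0 d = Pair 0 ` degrees 0 d" by (auto simp: indices_def cofactor_indices_def)
  moreover have "inj_on (Pair (0::nat)) (degrees 0 d)" by (simp add: inj_on_def)
  ultimately show "piece d 0 c p =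
      combination (monomial (edge 0) (edge (Suc 0))) (degrees 0 d) (\<lambda>ij. c (0, ij)) p"
    by (simp add: piece_def combination_def sum.reindex generator_def)
qed

lemma piece_Suc: "piece d (Suc m) c = (\<lambda>p. piece d m c p + (edge (Suc m) p)\<^sup>2 * cofactor d (Suc m) c p)"
proof
  fix p
  have eq: "indices (Suc m) d = indices m d \<union> Pair (Suc m) ` degrees 2 d"
    by (auto simp: indices_def cofactor_indices_def)
  have disj: "indices m d \<inter> Pair (Suc m) ` degrees 2 d = {}"
    by (auto simp: indices_def cofactor_indices_def)
  have "inj_on (Pair (Suc m)) (degrees 2 d)" by (simp add: inj_on_def)
  then show "piece d (Suc m) c p = piece d m c p + (edge (Suc m) p)\<^sup>2 * cofactor d (Suc m) c p"
    unfolding piece_def combination_def cofactor_def eq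
    by (subst sum.union_disjoint[OF _ _ disj])
       (simp_all add: sum.reindex generator_def sum_distrib_left mult_ac)
qed

lemma piece_period: "piece d period c = (\<lambda>p. piece d 0 c p + closing d c p)"
proof
  fix p
  have "indices period d = indices 0 d \<union> cofactor_indices period d"
    "indices 0 d \<inter> cofactor_indices period d = {}"
    by (auto simp: indices_def cofactor_indices_def)
  then show "piece d period c p = piece d 0 c p + closing d c p"
    unfolding piece_def combination_def closing_def by (simp add: sum.union_disjoint)
qed

lemma piece_in: "piece d m c \<in> polys 0 d"
proof (induction m)
  case 0
  then show ?case
    using combination_in_span[OF order_refl, of "monomial (edge 0) (edge (Suc 0))" "degrees 0 d"]
    unfolding piece_0 poly_space_def[symmetric] by simp
next
  case (Suc m)
  then show ?case
    unfolding piece_Suc by (intro poly_space_add edge_form_square_mult cofactor_in)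
qed

lemma agree1_piece_Suc: "edge (Suc m) p = 0 \<Longrightarrow> agree1 (piece d m c) (piece d (Suc m) c) p"
  unfolding piece_Suc
  by (intro agree1_add_square real_polynomial_function_edge_form
      real_polynomial_function_polys[OF cofactor_in])

lemma agree1_piece_center: "agree1 (piece d 0 c) (piece d m c) v"
proof (induction m)
  case (Suc m)
  then show ?case by (rule agree1_trans) (rule agree1_piece_Suc, simp add: edge_form_def)
qed (rule agree1_refl)

lemma cell_index:
  assumes "p \<in> \<Union>\<Delta>"
  shows "p \<in> cell (cell_index p)" "cell_index p < period"
proof -
  obtain i where i: "p \<in> cell i" "i < period" using assms cells_image by auto
  then show "p \<in> cell (cell_index p)" unfolding cell_index_def by (intro LeastI)
  show "cell_index p < period"
    using i Least_le[of "\<lambda>i. p \<in> cell i" i] unfolding cell_index_def by simp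
qed

text \<open>Different cells through \<open>p\<close> are adjacent unless \<open>p\<close> is the
  center, where all edge forms vanish.\<close>

lemma agree1_pieces:
  assumes closed: "closing d c = 0" and p: "p \<in> cell i" "p \<in> cell j" and ij: "i < period" "j < period"
  shows "agree1 (piece d i c) (piece d j c) p"
proof -
  have step: "agree1 (piece d k c) (piece d l c) p"
    if kl: "cell l = cell (Suc k)" "k < period" "l < period" "p \<in> cell k" "p \<in> cell l" for k l
  proof -
    have "edge (Suc k) p = 0"
      using common_edge_parallel[of p k] kl by (simp add: edge_form_def del: cross2_linear)
    then have *: "agree1 (piece d k c) (piece d (Suc k) c) p" by (rule agree1_piece_Suc)
    show ?thesis
    \<comment> \<open>Crossing the edge from the last cell to cell 0 is where the closing condition
      enters.\<close>
    proof (cases "Suc k = period")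
      case True
      then have "l = 0"
        using kl inj_on_cell period cell_period_add[of 0] by (auto simp: inj_on_def)
      then show ?thesis using * True piece_period[of d c] closed by simp
    next
      case False
      then have "l = Suc k" using kl inj_on_cell by (auto simp: inj_on_def)
      then show ?thesis using * by simp
    qed
  qed
  consider "i = j" | "p = v" | "cell j = cell (Suc i)" | "cell i = cell (Suc j)"
    using shared_point_cell[OF p] ij inj_on_cell by (auto simp: inj_on_def)
  then show ?thesis
  proof cases
    case 2
    then show ?thesis using agree1_piece_center agree1_sym agree1_trans by metis
  qed (use step[of j i] step[of i j] p ij agree1_sym agree1_refl in metis)+
qed

lemma spline_eq_piece:
  assumes "closing d c = 0" "p \<in> cell i" "i < period"
  shows "spline d c p = piece d i c p"
proof -
  have "p \<in> \<Union>\<Delta>" using assms(2) cell_in by blast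
  then show ?thesis
    using agree1_pieces[OF assms(1) _ assms(2) _ assms(3), of "cell_index p"] cell_index
    by (simp add: spline_def agree1_def)
qed

text \<open>First-order agreement makes the cellwise derivatives a single function, which is
  continuous because the cells form a finite closed cover.\<close>

lemma spline_in:
  assumes "closing d c = 0"
  shows "spline d c \<in> C1_splines \<Delta> d"
proof -
  have "\<exists>G :: real^2 \<Rightarrow> ((real^2) \<Rightarrow>\<^sub>L real).
      (\<forall>p. (piece d i c has_derivative blinfun_apply (G p)) (at p)) \<and> continuous_on UNIV G" for i
    using real_polynomial_function_C1[OF real_polynomial_function_polys[OF piece_in], of UNIV]
    unfolding C1_on_def by auto
  then obtain G :: "nat \<Rightarrow> real^2 \<Rightarrow> ((real^2) \<Rightarrow>\<^sub>L real)" where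
    G: "\<And>i p. (piece d i c has_derivative blinfun_apply (G i p)) (at p)" "\<And>i. continuous_on UNIV (G i)"
    by metis
  define F' where "F' p = G (cell_index p) p" for p
  have F'_eq: "F' p = G i p" if "p \<in> cell i" "i < period" for p i
  proof -
    have "p \<in> \<Union>\<Delta>" using that(1) cell_in by blast
    then have "agree1 (piece d (cell_index p) c) (piece d i c) p"
      using cell_index that by (intro agree1_pieces[OF assms]) auto
    then show ?thesis
      unfolding F'_def using agree1_has_derivative[OF _ G(1) G(1)] blinfun_apply_inject by metis
  qed
  have deriv: "(spline d c has_derivative blinfun_apply (F' p)) (at p within \<Union>\<Delta>)" if "p \<in> \<Union>\<Delta>" for p
  proof (rule has_derivative_within_Union_closed[OF finite_cells closed_cell that])
    fix T assume T: "T \<in> \<Delta>" "p \<in> T"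
    then obtain i where i: "T = cell i" "i < period" using cells_image by auto
    show "(spline d c has_derivative blinfun_apply (F' p)) (at p within T)"
    proof (rule has_derivative_transform[where f = "piece d i c"])
      show "(piece d i c has_derivative blinfun_apply (F' p)) (at p within T)"
        using F'_eq[of p i] G(1)[of i p] T i has_derivative_at_withinI by metis
    qed (use T i spline_eq_piece[OF assms] in auto)
  qed
  have "continuous_on (\<Union>i\<in>{..<period}. cell i) F'"
  proof (rule continuous_on_closed_Union)
    fix i assume "i \<in> {..<period}"
    then show "continuous_on (cell i) F'"
      using F'_eq[of _ i] continuous_on_subset[OF G(2)[of i]] continuous_on_cong[of "cell i" "cell i" F' "G i"]
      by auto
  qed (simp_all add: closed_cell)
  then have "continuous_on (\<Union>\<Delta>) F'" using cells_image by metis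
  then have "C1_on (\<Union>\<Delta>) (spline d c)" unfolding C1_on_def using deriv by blast
  moreover have "\<exists>P. polynomial_le d P \<and> (\<forall>p\<in>T. spline d c p = P p)" if T: "T \<in> \<Delta>" for T
  proof -
    obtain i where i: "T = cell i" "i < period" using cells_image T by auto
    then show ?thesis
      using spline_eq_piece[OF assms] piece_in polynomial_le_iff by (intro exI[of _ "piece d i c"]) auto
  qed
  ultimately show ?thesis unfolding C1_splines_def by (simp add: spline_def)
qed

lemma interior_cell_nonempty: "interior (cell i) \<noteq> {}"
  unfolding cell_w using orient_w by (rule interior_triangle_nonempty)

lemma zero_on_cell:
  assumes "P \<in> polys k d" "\<And>p. p \<in> cell i \<Longrightarrow> P p = 0"
  shows "P = 0"
proof -
  obtain q where "q \<in> interior (cell i)" using interior_cell_nonempty by blast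
  then have "P p = 0" for p
    using real_polynomial_function_zero_on_open[OF real_polynomial_function_polys[OF assms(1)] open_interior]
      assms(2) interior_subset by blast
  then show ?thesis by (simp add: fun_eq_iff)
qed

lemma coefficients_zero:
  assumes "combination (monomial (edge 0) (edge (Suc 0))) (degrees k d) c = 0" "a \<in> degrees k d"
  shows "c a = 0"
  by (rule combination_monomial_eq_0[OF edge_forms_surj[of "w 0" "w (Suc 0)" v] finite_degrees])
     (use assms orient_w[of 0] in auto)

lemma spline_injective:
  assumes c: "c \<in> supported (indices period d)" "closing d c = 0" and "spline d c = 0"
  shows "c = 0"
proof -
  have piece: "piece d m c = 0" if "m < period" for m
    using zero_on_cell[OF piece_in, of m d m c] spline_eq_piece[OF c(2) _ that] assms(3) by simp
  \<comment> \<open>The index \<open>period\<close> is included: the last cofactor is a jump to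
    \<open>piece d period c\<close>.\<close>
  have pieces: "piece d m c = 0" if "m \<le> period" for m
    using piece[of m] piece[of 0] period(1) that piece_period[of d c] c(2)
    by (cases "m = period") (auto simp: fun_eq_iff)
  have "cofactor d (Suc m) c = 0" if "Suc m \<le> period" for m
  proof -
    have 0: "(edge (Suc m) p)\<^sup>2 * cofactor d (Suc m) c p = 0" for p
      using pieces[of m] pieces[of "Suc m"] that fun_cong[OF piece_Suc[of d m c], of p] by simp
    \<comment> \<open>Off the edge line the squared form can be cancelled; the identity theorem then
      covers the line.\<close>
    have U: "open {p. edge (Suc m) p \<noteq> 0}"
      unfolding edge_form_def by (intro open_Collect_neq continuous_intros)
    obtain q where q: "edge (Suc m) q = 1"
      using edge_forms_surj[of "w (Suc m)" "w (Suc (Suc m))" v 1 0] orient_w[of "Suc m"] by auto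
    have "cofactor d (Suc m) c p = 0" for p
      by (rule real_polynomial_function_zero_on_open[OF real_polynomial_function_polys[OF cofactor_in] U,
          where q = q]) (use 0 q in auto)
    then show ?thesis by (simp add: fun_eq_iff)
  qed
  then have cof: "c (Suc m, a) = 0" if "Suc m \<le> period" "a \<in> degrees 2 d" for m a
    using coefficients_zero[of 2 d "\<lambda>ij. c (Suc m, ij)"] that unfolding cofactor_def by simp
  have zero: "c (0, a) = 0" if "a \<in> degrees 0 d" for a
    using coefficients_zero[of 0 d "\<lambda>ij. c (0, ij)"] that pieces[of 0] unfolding piece_0 by simp
  have "c (k, a) = 0" for k a
  proof (cases "(k, a) \<in> indices period d")
    case True
    then show ?thesis using cof[of "k - 1" a] zero[of a]
      by (auto simp: indices_def cofactor_indices_def)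
  next
    case False
    then show ?thesis using c(1) by (simp add: supported_def del: split_paired_All)
  qed
  then show ?thesis by (simp add: fun_eq_iff)
qed

section \<open>From a spline back to its cofactors\<close>

text \<open>In the interior of the cell this is uniqueness of derivatives. The cell is the closure
  of its interior, and both derivatives are continuous.\<close>

lemma has_derivative_unique_on_cell:
  assumes F: "\<And>p. p \<in> \<Union>\<Delta> \<Longrightarrow> (F has_derivative blinfun_apply (F' p)) (at p within \<Union>\<Delta>)"
      "continuous_on (\<Union>\<Delta>) F'"
    and P: "real_polynomial_function P" "\<And>p. p \<in> cell i \<Longrightarrow> F p = P p" and p: "p \<in> cell i"
  shows "(P has_derivative blinfun_apply (F' p)) (at p)"
proof -
  obtain G :: "real^2 \<Rightarrow> ((real^2) \<Rightarrow>\<^sub>L real)" where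
    G: "\<And>p. (P has_derivative blinfun_apply (G p)) (at p)" "continuous_on UNIV G"
    using real_polynomial_function_C1[OF P(1), of UNIV] unfolding C1_on_def by auto
  have sub: "cell i \<subseteq> \<Union>\<Delta>" using cell_in by blast
  have int: "F' q - G q = 0" if q: "q \<in> interior (cell i)" for q
  proof -
    have qc: "q \<in> cell i" using q interior_subset by blast
    have "(F has_derivative blinfun_apply (F' q)) (at q within cell i)"
      using F(1)[of q] sub qc by (meson has_derivative_subset subsetD)
    then have "(P has_derivative blinfun_apply (F' q)) (at q within cell i)"
      by (rule has_derivative_transform[OF qc, rotated]) (simp add: P(2))
    then have "(P has_derivative blinfun_apply (F' q)) (at q)"
      using at_within_interior[OF q] by simp
    then have "blinfun_apply (F' q) = blinfun_apply (G q)" using G(1) has_derivative_unique by blast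
    then show ?thesis by (simp add: blinfun_apply_inject)
  qed
  have "closure (interior (cell i)) = cell i"
    using convex_closure_interior[OF convex_cell[OF cell_in] interior_cell_nonempty]
      closed_cell[OF cell_in] by simp
  moreover have "continuous_on (cell i) (\<lambda>q. F' q - G q)"
    using F(2) G(2) sub by (intro continuous_intros) (meson continuous_on_subset subset_UNIV)+
  ultimately have "F' p - G p = 0"
    using continuous_constant_on_closure[of "interior (cell i)" "\<lambda>q. F' q - G q" 0 p] int p by simp
  then show ?thesis using G(1)[of p] by simp
qed

lemma edge_point_in:
  assumes "0 < t" "t < 1"
  shows "v + t *\<^sub>R w (Suc i) \<in> cell i" "v + t *\<^sub>R w (Suc i) \<in> cell (Suc i)"
proof -
  have "v + t *\<^sub>R w (Suc i) \<in> closed_segment v (v + w (Suc i))"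
    unfolding in_segment using assms by (intro exI[of _ t]) (simp add: algebra_simps)
  then show "v + t *\<^sub>R w (Suc i) \<in> cell i" "v + t *\<^sub>R w (Suc i) \<in> cell (Suc i)"
    unfolding cell_Int_Suc[symmetric] by simp_all
qed

lemma spline_surj:
  assumes "F \<in> C1_splines \<Delta> d"
  shows "\<exists>c\<in>supported (indices period d). closing d c = 0 \<and> F = spline d c"
proof -
  have F0: "\<And>p. p \<notin> \<Union>\<Delta> \<Longrightarrow> F p = 0" and C1: "C1_on (\<Union>\<Delta>) F"
    and "\<forall>T\<in>\<Delta>. \<exists>P. polynomial_le d P \<and> (\<forall>p\<in>T. F p = P p)"
    using assms unfolding C1_splines_def mem_Collect_eq by blast+
  then obtain Q where Q: "\<forall>T\<in>\<Delta>. polynomial_le d (Q T) \<and> (\<forall>p\<in>T. F p = Q T p)" by metis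
  define P where "P i = Q (cell i)" for i
  have P: "P i \<in> polys 0 d" "\<And>p. p \<in> cell i \<Longrightarrow> F p = P i p" for i
    using Q polynomial_le_iff by (auto simp: P_def)
  obtain F' :: "real^2 \<Rightarrow> ((real^2) \<Rightarrow>\<^sub>L real)" where
    F': "\<And>p. p \<in> \<Union>\<Delta> \<Longrightarrow> (F has_derivative blinfun_apply (F' p)) (at p within \<Union>\<Delta>)"
      "continuous_on (\<Union>\<Delta>) F'"
    using C1 unfolding C1_on_def by blast
  have P': "(P i has_derivative blinfun_apply (F' p)) (at p)" if "p \<in> cell i" for i p
    using has_derivative_unique_on_cell[OF F' real_polynomial_function_polys[OF P(1)] P(2) that] .
  have "\<exists>R\<in>polys 2 d. (\<lambda>p. P (Suc i) p - P i p) = (\<lambda>p. (edge (Suc i) p)\<^sup>2 * R p)" for i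
  proof (rule divide_by_square[where b = "w (Suc (Suc i))"])
    let ?D = "cross2 (w (Suc i)) (w (Suc (Suc i)))"
    have D: "?D > 0" by (rule orient_w)
    then show "?D \<noteq> 0" by simp
    show "(\<lambda>p. P (Suc i) p - P i p) \<in> polys 0 d" by (intro poly_space_diff P)
    \<comment> \<open>At \<open>v + s *\<^sub>R w (Suc i)\<close> the second coordinate is
      \<open>- s * ?D\<close>; the interval is the open edge, 0 < s < 1.\<close>
    show "infinite {- ?D<..<0}" using D by (simp add: infinite_Ioo)
    fix t assume t: "t \<in> {- ?D<..<0}"
    define s where "s = - t / ?D"
    define p where "p = v + s *\<^sub>R w (Suc i)"
    have s: "0 < s" "s < 1" using t D by (simp_all add: s_def field_simps)
    have p: "p \<in> cell i" "p \<in> cell (Suc i)" unfolding p_def by (rule edge_point_in[OF s])+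
    have "((\<lambda>p. P (Suc i) p - P i p) has_derivative (\<lambda>h. 0)) (at p)"
      using has_derivative_diff[OF P'[OF p(2)] P'[OF p(1)]] by simp
    moreover have "edge (Suc i) p = 0" "edge_form v (w (Suc (Suc i))) p = t"
      using D cross2_commute[of "w (Suc (Suc i))" "w (Suc i)"] by (simp_all add: edge_form_def p_def s_def)
    moreover have "P (Suc i) p - P i p = 0" using P(2)[OF p(1)] P(2)[OF p(2)] by simp
    ultimately show "\<exists>p. edge (Suc i) p = 0 \<and> edge_form v (w (Suc (Suc i))) p = t \<and>
      P (Suc i) p - P i p = 0 \<and> ((\<lambda>p. P (Suc i) p - P i p) has_derivative (\<lambda>h. 0)) (at p)"
      by blast
  qed
  then have "\<forall>i. \<exists>R. R \<in> polys 2 d \<and> (\<lambda>p. P (Suc i) p - P i p) = (\<lambda>p. (edge (Suc i) p)\<^sup>2 * R p)"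
    by blast
  from choice[OF this] obtain R where R: "\<And>i. R i \<in> polys 2 d"
    "\<And>i. (\<lambda>p. P (Suc i) p - P i p) = (\<lambda>p. (edge (Suc i) p)\<^sup>2 * R i p)" by blast
  have "\<exists>c. R i = combination (monomial (edge 0) (edge (Suc 0))) (degrees 2 d) c" for i
    using R(1)[of i] in_span_combinationE[OF finite_degrees]
    unfolding coordinates[symmetric] poly_space_def by metis
  then obtain cR where cR: "\<And>i. R i = combination (monomial (edge 0) (edge (Suc 0))) (degrees 2 d) (cR i)"
    by metis
  obtain cP where cP: "P 0 = combination (monomial (edge 0) (edge (Suc 0))) (degrees 0 d) cP"
    using P(1)[of 0] in_span_combinationE[OF finite_degrees]
    unfolding coordinates[symmetric] poly_space_def by metis
  \<comment> \<open>\<open>R m\<close> is the jump from cell \<open>m\<close> to cell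
    \<open>Suc m\<close>, that is, the cofactor with index \<open>Suc m\<close>; hence the shift by
    one.\<close>
  define c where "c = (\<lambda>(k, ij). if (k, ij) \<in> indices period d then if k = 0 then cP ij else cR (k - 1) ij else 0)"
  have pieces: "piece d m c = P m" if "m \<le> period" for m
    using that
  proof (induction m)
    case 0
    show ?case unfolding piece_0 cP by (rule combination_cong) (simp add: c_def indices_def)
  next
    case (Suc m)
    have "cofactor d (Suc m) c = R m"
      unfolding cofactor_def cR using Suc.prems
      by (intro combination_cong) (simp add: c_def indices_def cofactor_indices_def)
    then show ?case using Suc fun_cong[OF R(2)[of m]] unfolding piece_Suc by (simp add: fun_eq_iff algebra_simps)
  qed
  have "P period = P 0" using period(2) by (simp add: P_def)
  then have closing: "closing d c = 0"
    using piece_period[of d c] pieces[of 0] pieces[of period] by (simp add: fun_eq_iff)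
  have "F p = spline d c p" for p
    using F0[of p] cell_index[of p] P(2)[of p "cell_index p"] pieces[of "cell_index p"]
    by (cases "p \<in> \<Union>\<Delta>") (auto simp: spline_def)
  moreover have "c \<in> supported (indices period d)" by (auto simp: supported_def c_def)
  ultimately show ?thesis using closing by (intro bexI[of _ c]) (auto simp: fun_eq_iff)
qed

lemma linear_spline: "Vector_Spaces.linear coeff_scale scale_fun (spline d)"
proof -
  have "combination g A (c + c') p = combination g A c p + combination g A c' p"
    "combination g A (coeff_scale r c) p = r * combination g A c p" for g and A :: "(nat \<times> nat \<times> nat) set" and c c' r p
    by (simp_all add: combination_def coeff_scale_def sum.distrib sum_distrib_left algebra_simps)
  then show ?thesis
    unfolding Vector_Spaces.linear_iff
    by (auto simp: spline_def piece_def scale_fun_def fun_eq_iff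
        intro: coeff.vector_space_axioms fun_vs.vector_space_axioms)
qed

lemma card_indices: "card (indices period d) = card (degrees 0 d) + period * card (degrees 2 d)"
  unfolding indices_def cofactor_indices_def
  by (subst card_Un_disjoint) (auto simp: card_cartesian_product)

text \<open>Rank-nullity for \<open>closing\<close>, whose kernel is carried bijectively to the
  spline space by \<open>spline\<close>. The additive form avoids truncated subtraction.\<close>

theorem dim_C1_splines:
  "fun_vs.dim (C1_splines \<Delta> d) + fun_vs.dim (fun_vs.span (generator ` cofactor_indices period d)) =
    card (degrees 0 d) + period * card (degrees 2 d)"
proof -
  let ?A = "indices period d" and ?C = "cofactor_indices period d"
  let ?K = "{c \<in> supported ?A. closing d c = 0}"
  have lin: "Vector_Spaces.linear coeff_scale scale_fun (closing d)"
    unfolding closing_def by (rule linear_combination)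
  have "C1_splines \<Delta> d = spline d ` ?K"
    using spline_in spline_surj by blast
  moreover have "fun_vs.dim (spline d ` ?K) = coeff.dim ?K"
  proof (rule coeff_fun.dim_injective_image[OF linear_spline])
    show "coeff.subspace ?K"
      using coeff.subspace_inter[OF subspace_supported coeff_fun.linear_subspace_kernel[OF lin]]
      by (simp add: Collect_conj_eq)
    show "?K \<subseteq> coeff.span ((\<lambda>a. indicat_real {a}) ` ?A)"
      using supported_subset_span[of ?A] by auto
  qed (use spline_injective in auto)
  \<comment> \<open>The coefficients of the polynomial on cell 0 do not enter
    \<open>closing\<close>.\<close>
  moreover have "closing d ` supported ?A = closing d ` supported ?C"
  proof
    show "closing d ` supported ?C \<subseteq> closing d ` supported ?A"
      by (intro image_mono) (auto simp: supported_def indices_def)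
    show "closing d ` supported ?A \<subseteq> closing d ` supported ?C"
    proof
      fix P assume "P \<in> closing d ` supported ?A"
      then obtain c where "P = closing d c" by blast
      also have "\<dots> = closing d (\<lambda>a. if a \<in> ?C then c a else 0)"
        unfolding closing_def by (rule combination_cong) simp
      finally show "P \<in> closing d ` supported ?C" by (auto simp: supported_def)
    qed
  qed
  then have "closing d ` supported ?A = fun_vs.span (generator ` ?C)"
    by (simp add: closing_def span_eq_combination_image)
  moreover have "coeff.dim (supported ?A) = fun_vs.dim (closing d ` supported ?A) + coeff.dim ?K"
    by (rule coeff_fun.dim_image_add_dim_kernel[OF lin subspace_supported supported_subset_span]) simp_all
  ultimately show ?thesis using dim_supported[of ?A] card_indices by simp
qed

section \<open>The span of the squared edge forms times monomials\<close>

lemma edge_combination: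
  "\<exists>\<alpha> \<beta>. (\<forall>p. edge k p = \<alpha> * edge 0 p + \<beta> * edge (Suc 0) p) \<and>
    (\<alpha> = 0 \<longleftrightarrow> cross2 (w (Suc 0)) (w k) = 0) \<and> (\<beta> = 0 \<longleftrightarrow> cross2 (w 0) (w k) = 0)"
proof (intro exI conjI allI)
  let ?D = "cross2 (w 0) (w (Suc 0))"
  have D: "?D > 0" by (rule orient_w)
  show "edge k p = (cross2 (w k) (w (Suc 0)) / ?D) * edge 0 p + (cross2 (w 0) (w k) / ?D) * edge (Suc 0) p" for p
    unfolding edge_form_def using D
    by (subst cross2_expand[of "w 0" "w (Suc 0)" "w k"]) (simp_all only: cross2_linear, simp add: field_simps)
  show "cross2 (w k) (w (Suc 0)) / ?D = 0 \<longleftrightarrow> cross2 (w (Suc 0)) (w k) = 0"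
    "cross2 (w 0) (w k) / ?D = 0 \<longleftrightarrow> cross2 (w 0) (w k) = 0"
    using D cross2_commute[of "w k" "w (Suc 0)"] by auto
qed

abbreviation edge_monomial :: "nat \<times> nat \<Rightarrow> real^2 \<Rightarrow> real" where
  "edge_monomial \<equiv> monomial (edge 0) (edge (Suc 0))"

lemma square_monomial_in:
  assumes "i + j + 2 \<le> d"
  shows "(\<lambda>p. (edge 0 p)\<^sup>2 * edge_monomial (i, j) p) \<in> fun_vs.span (generator ` cofactor_indices period d)"
    and "(\<lambda>p. (edge (Suc 0) p)\<^sup>2 * edge_monomial (i, j) p) \<in> fun_vs.span (generator ` cofactor_indices period d)"
proof -
  have "(\<lambda>p. (edge k p)\<^sup>2 * edge_monomial (i, j) p) \<in> fun_vs.span (generator ` cofactor_indices period d)"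
    if "1 \<le> k" "k \<le> period" for k
  proof -
    have "generator (k, i, j) = (\<lambda>p. (edge k p)\<^sup>2 * edge_monomial (i, j) p)"
      using that by (simp add: generator_def)
    moreover have "(k, i, j) \<in> cofactor_indices period d"
      using that assms by (simp add: cofactor_indices_def degrees_def)
    ultimately show ?thesis by (metis fun_vs.span_base imageI)
  qed
  \<comment> \<open>Cofactors are numbered from 1, so the square of \<open>edge 0\<close> comes from
    the index \<open>period\<close>.\<close>
  from this[of period] this[of "Suc 0"] show
    "(\<lambda>p. (edge 0 p)\<^sup>2 * edge_monomial (i, j) p) \<in> fun_vs.span (generator ` cofactor_indices period d)"
    "(\<lambda>p. (edge (Suc 0) p)\<^sup>2 * edge_monomial (i, j) p) \<in> fun_vs.span (generator ` cofactor_indices period d)"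
    using period(1) w_period by simp_all
qed

lemma monomial_square_mult:
  "edge_monomial (i + 2, j) = (\<lambda>p. (edge 0 p)\<^sup>2 * edge_monomial (i, j) p)"
  "edge_monomial (i, j + 2) = (\<lambda>p. (edge (Suc 0) p)\<^sup>2 * edge_monomial (i, j) p)"
  by (simp_all add: monomial_def fun_eq_iff power_add power2_eq_square)

lemma monomial_in_generators:
  assumes "i + j \<le> d" "2 \<le> i \<or> 2 \<le> j"
  shows "edge_monomial (i, j) \<in> fun_vs.span (generator ` cofactor_indices period d)"
  using assms(2)
proof
  assume "2 \<le> i"
  then obtain m where "i = m + 2" by (metis add.commute le_Suc_ex)
  then show ?thesis using square_monomial_in(1)[of m j d] assms(1) by (simp add: monomial_square_mult del: add_2_eq_Suc')
next
  assume "2 \<le> j"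
  then obtain m where "j = m + 2" by (metis add.commute le_Suc_ex)
  then show ?thesis using square_monomial_in(2)[of i m d] assms(1) by (simp add: monomial_square_mult del: add_2_eq_Suc')
qed

lemma generator_expand:
  assumes "\<And>p. edge k p = \<alpha> * edge 0 p + \<beta> * edge (Suc 0) p" "k \<noteq> 0"
  shows "generator (k, i, j) = (\<lambda>p. \<alpha>\<^sup>2 * edge_monomial (i + 2, j) p +
    (2 * \<alpha> * \<beta>) * edge_monomial (i + 1, j + 1) p + \<beta>\<^sup>2 * edge_monomial (i, j + 2) p)"
  using assms
  by (simp add: generator_def monomial_def fun_eq_iff power2_eq_square power_add algebra_simps)

lemma span_generators_two_directions:
  assumes "\<And>k. cross2 (w 0) (w k) = 0 \<or> cross2 (w 1) (w k) = 0"
  shows "fun_vs.span (generator ` cofactor_indices period d) =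
    fun_vs.span (edge_monomial ` {(i, j). i + j \<le> d \<and> (2 \<le> i \<or> 2 \<le> j)})"
proof (intro subset_antisym fun_vs.span_minimal fun_vs.subspace_span)
  let ?I = "{(i, j). i + j \<le> d \<and> (2 \<le> i \<or> 2 \<le> j)}"
  show "edge_monomial ` ?I \<subseteq> fun_vs.span (generator ` cofactor_indices period d)"
    using monomial_in_generators by auto
  show "generator ` cofactor_indices period d \<subseteq> fun_vs.span (edge_monomial ` ?I)"
  proof
    fix g assume "g \<in> generator ` cofactor_indices period d"
    then obtain k i j where g: "g = generator (k, i, j)" "k \<noteq> 0" "i + j + 2 \<le> d"
      by (auto simp: cofactor_indices_def degrees_def)
    obtain \<alpha> \<beta> where \<alpha>\<beta>: "\<And>p. edge k p = \<alpha> * edge 0 p + \<beta> * edge (Suc 0) p"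
      "\<alpha> = 0 \<longleftrightarrow> cross2 (w (Suc 0)) (w k) = 0" "\<beta> = 0 \<longleftrightarrow> cross2 (w 0) (w k) = 0"
      using edge_combination[of k] by blast
    \<comment> \<open>Removes the mixed term of the expanded square.\<close>
    have zero: "\<alpha> * \<beta> = 0" using \<alpha>\<beta>(2,3) assms[of k] by auto
    have "edge_monomial (i + 2, j) \<in> fun_vs.span (edge_monomial ` ?I)" "edge_monomial (i, j + 2) \<in> fun_vs.span (edge_monomial ` ?I)"
      using g(3) by (auto intro!: fun_vs.span_base)
    from span_lincomb3[OF this(1) this(2) this(2), of "\<alpha>\<^sup>2" 0 "\<beta>\<^sup>2"]
    show "g \<in> fun_vs.span (edge_monomial ` ?I)"
      unfolding g(1) generator_expand[OF \<alpha>\<beta>(1) g(2)] mult.assoc[of 2 \<alpha> \<beta>] zero by simp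
  qed
qed

text \<open>Of the monomials of degree at least 2, only the product of the two coordinates is
  divisible by neither square. It is obtained by solving the expanded square of the third form for
  its mixed term.\<close>

lemma span_generators_three_directions:
  assumes "cross2 (w 0) (w l) \<noteq> 0" "cross2 (w 1) (w l) \<noteq> 0"
  shows "fun_vs.span (generator ` cofactor_indices period d) =
    fun_vs.span (edge_monomial ` {(i, j). i + j \<le> d \<and> 2 \<le> i + j})"
proof (intro subset_antisym fun_vs.span_minimal fun_vs.subspace_span)
  let ?I = "{(i, j). i + j \<le> d \<and> 2 \<le> i + j}"
  show "generator ` cofactor_indices period d \<subseteq> fun_vs.span (edge_monomial ` ?I)"
  proof
    fix g assume "g \<in> generator ` cofactor_indices period d"
    then obtain k i j where g: "g = generator (k, i, j)" "k \<noteq> 0" "i + j + 2 \<le> d"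
      by (auto simp: cofactor_indices_def degrees_def)
    obtain \<alpha> \<beta> where \<alpha>\<beta>: "\<And>p. edge k p = \<alpha> * edge 0 p + \<beta> * edge (Suc 0) p"
      using edge_combination[of k] by blast
    have "edge_monomial (i + 2, j) \<in> fun_vs.span (edge_monomial ` ?I)" "edge_monomial (i + 1, j + 1) \<in> fun_vs.span (edge_monomial ` ?I)"
      "edge_monomial (i, j + 2) \<in> fun_vs.span (edge_monomial ` ?I)"
      using g(3) by (auto intro!: fun_vs.span_base)
    then show "g \<in> fun_vs.span (edge_monomial ` ?I)"
      unfolding g(1) generator_expand[OF \<alpha>\<beta> g(2)] by (rule span_lincomb3)
  qed
  \<comment> \<open>Brings the third direction into the range of cofactor indices; the value 0 is
    excluded since \<open>w l\<close> is not parallel to \<open>w 0\<close>.\<close>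
  define k where "k = l mod period"
  have wk: "w k = w l" using cell_mod[of l] by (simp add: k_def w_def)
  then have k: "k \<noteq> 0" "k < period" using assms(1) period(1) by (auto simp: k_def intro!: Nat.gr0I)
  obtain \<alpha> \<beta> where \<alpha>\<beta>: "\<And>p. edge k p = \<alpha> * edge 0 p + \<beta> * edge (Suc 0) p"
    "\<alpha> = 0 \<longleftrightarrow> cross2 (w (Suc 0)) (w k) = 0" "\<beta> = 0 \<longleftrightarrow> cross2 (w 0) (w k) = 0"
    using edge_combination[of k] by blast
  then have nz: "\<alpha> \<noteq> 0" "\<beta> \<noteq> 0" using assms wk by simp_all
  show "edge_monomial ` ?I \<subseteq> fun_vs.span (generator ` cofactor_indices period d)"
  proof (rule image_subsetI)
    fix a assume "a \<in> ?I"
    then obtain i j where a: "a = (i, j)" "i + j \<le> d" "2 \<le> i + j" by blast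
    show "edge_monomial a \<in> fun_vs.span (generator ` cofactor_indices period d)"
    proof (cases "2 \<le> i \<or> 2 \<le> j")
      case True
      then show ?thesis unfolding a(1) by (rule monomial_in_generators[OF a(2)])
    next
      case False
      \<comment> \<open>Written as sums to match the exponents in
        \<open>generator_expand\<close>.\<close>
      then have ij: "i = 0 + 1" "j = 0 + 1" and d: "2 \<le> d" using a by auto
      have "(k, 0, 0) \<in> cofactor_indices period d"
        using k d by (simp add: cofactor_indices_def degrees_def)
      then have "generator (k, 0, 0) \<in> fun_vs.span (generator ` cofactor_indices period d)"
        by (intro fun_vs.span_base imageI)
      from span_lincomb3[OF this monomial_in_generators[of "0 + 2" 0 d] monomial_in_generators[of 0 "0 + 2" d],
          of "1 / (2 * \<alpha> * \<beta>)" "- \<alpha>\<^sup>2 / (2 * \<alpha> * \<beta>)" "- \<beta>\<^sup>2 / (2 * \<alpha> * \<beta>)"]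
      have "(\<lambda>p. 1 / (2 * \<alpha> * \<beta>) * generator (k, 0, 0) p + - \<alpha>\<^sup>2 / (2 * \<alpha> * \<beta>) * edge_monomial (0 + 2, 0) p +
          - \<beta>\<^sup>2 / (2 * \<alpha> * \<beta>) * edge_monomial (0, 0 + 2) p) \<in> fun_vs.span (generator ` cofactor_indices period d)"
        using d by simp
      also have "(\<lambda>p. 1 / (2 * \<alpha> * \<beta>) * generator (k, 0, 0) p + - \<alpha>\<^sup>2 / (2 * \<alpha> * \<beta>) * edge_monomial (0 + 2, 0) p +
          - \<beta>\<^sup>2 / (2 * \<alpha> * \<beta>) * edge_monomial (0, 0 + 2) p) = edge_monomial (0 + 1, 0 + 1)"
        unfolding generator_expand[OF \<alpha>\<beta>(1) k(1)] using nz by (simp add: fun_eq_iff field_simps)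
      finally show ?thesis unfolding a(1) ij .
    qed
  qed
qed

lemma mono_surj: "\<exists>p. edge 0 p = s \<and> edge (Suc 0) p = t"
  using orient_w[of 0] by (intro edge_forms_surj) simp

end

section \<open>Counting monomials and the final arithmetic\<close>

lemma num_monomials_Suc: "num_monomials (Suc n) = num_monomials n + n + 2"
proof -
  have "(Suc n + 1) * (Suc n + 2) = (n + 1) * (n + 2) + (n + 2) * 2" by simp
  then show ?thesis unfolding num_monomials_def by simp
qed

lemma card_degrees_0: "card (degrees 0 n) = num_monomials n"
proof (induction n)
  case 0
  have "degrees 0 0 = {(0, 0)}" by (auto simp: degrees_def)
  then show ?case by (simp add: num_monomials_def)
next
  case (Suc n)
  have "degrees 0 (Suc n) = degrees 0 n \<union> (\<lambda>i. (i, Suc n - i)) ` {..Suc n}"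
    by (auto simp: degrees_def image_iff)
  moreover have "degrees 0 n \<inter> (\<lambda>i. (i, Suc n - i)) ` {..Suc n} = {}"
    by (auto simp: degrees_def)
  moreover have "card ((\<lambda>i. (i, Suc n - i)) ` {..Suc n}) = n + 2"
    by (subst card_image) (auto simp: inj_on_def)
  ultimately show ?case using Suc by (simp add: card_Un_disjoint num_monomials_Suc)
qed

lemma card_degrees_2: "card (degrees 2 d) = (if d \<le> 1 then 0 else num_monomials (d - 2))"
proof (cases "d \<le> 1")
  case True
  then have "degrees 2 d = {}" by (auto simp: degrees_def)
  then show ?thesis using True by simp
next
  case False
  then have "degrees 2 d = degrees 0 (d - 2)" by (auto simp: degrees_def)
  then show ?thesis using False card_degrees_0 by simp
qed

text \<open>The missing monomials are 1, x, y in the first count and 1, x, y, xy in the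
  second.\<close>

lemma card_degrees_minus:
  assumes "2 \<le> d"
  shows "card {(i, j). i + j \<le> d \<and> 2 \<le> i + j} + 3 = num_monomials d"
    and "card {(i, j). i + j \<le> d \<and> (2 \<le> i \<or> 2 \<le> j)} + 4 = num_monomials d"
proof -
  have *: "card (degrees 0 d - S) + card S = num_monomials d" if "S \<subseteq> degrees 0 d" for S
    using that card_Diff_subset[OF finite_subset[OF that finite_degrees] that] card_mono[OF finite_degrees that]
    by (simp add: card_degrees_0)
  have "{(i, j). i + j \<le> d \<and> 2 \<le> i + j} = degrees 0 d - {(0, 0), (0, 1), (1, 0)}"
    by (auto simp: degrees_def)
  then show "card {(i, j). i + j \<le> d \<and> 2 \<le> i + j} + 3 = num_monomials d"
    using *[of "{(0, 0), (0, 1), (1, 0)}"] assms by (simp add: degrees_def)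
  have "{(i, j). i + j \<le> d \<and> (2 \<le> i \<or> 2 \<le> j)} = degrees 0 d - {(0, 0), (0, 1), (1, 0), (1, 1)}"
    by (auto simp: degrees_def)
  then show "card {(i, j). i + j \<le> d \<and> (2 \<le> i \<or> 2 \<le> j)} + 4 = num_monomials d"
    using *[of "{(0, 0), (0, 1), (1, 0), (1, 1)}"] assms by (simp add: degrees_def)
qed

theorem corollary6p15:
  fixes \<Delta> :: "(real^2) set set" and n d :: nat
  assumes "pinwheel_triangulation \<Delta>" and "card \<Delta> = n"
  shows "(n = 4 \<and> has_singular_vertex \<Delta> \<longrightarrow>
            fun_vs.dim (C1_splines \<Delta> d) =
              (if d \<le> 1 then num_monomials d
               else if d \<le> 3 then num_monomials d + 2 * num_monomials (d - 2)
               else num_monomials d + 2 * num_monomials (d - 2) + num_monomials (d - 4))) \<and>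
         (n \<ge> 3 \<and> \<not> has_singular_vertex \<Delta> \<longrightarrow>
            fun_vs.dim (C1_splines \<Delta> d) =
              (if d \<le> 1 then num_monomials d
               else if d = 2 then num_monomials d + (n - 3) * num_monomials (d - 2)
               else num_monomials d + (n - 3) * num_monomials (d - 2) + 2 * num_monomials (d - 3)))"
proof -
  obtain v st en where "triangle_fan \<Delta> v st en"
    using assms(1) by (rule pinwheel_triangle_fan)
  then interpret triangle_fan \<Delta> v st en .
  have period: "period = n" using assms(2) by (simp add: period_eq_card)
  have fin: "finite {(i, j). i + j \<le> d \<and> Q i j}" for Q :: "nat \<Rightarrow> nat \<Rightarrow> bool"
    by (rule finite_subset[OF _ finite_degrees[of 0 d]]) (auto simp: degrees_def)
  have dim: "fun_vs.dim (C1_splines \<Delta> d) + card {(i, j). i + j \<le> d \<and> Q i j} =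
      num_monomials d + n * (if d \<le> 1 then 0 else num_monomials (d - 2))"
    if "fun_vs.span (generator ` cofactor_indices period d) = fun_vs.span (edge_monomial ` {(i, j). i + j \<le> d \<and> Q i j})" for Q
    using dim_C1_splines[of d, unfolded that dim_span_monomials[OF mono_surj fin]]
    by (simp add: period card_degrees_0 card_degrees_2)
  \<comment> \<open>With degree at most 1 there are no cofactors, and every spline is one global
    polynomial.\<close>
  have low: "fun_vs.dim (C1_splines \<Delta> d) = num_monomials d" if "d \<le> 1"
  proof -
    have "cofactor_indices period d = {}" using that by (auto simp: cofactor_indices_def degrees_def)
    then have "fun_vs.dim (fun_vs.span (generator ` cofactor_indices period d)) = 0"
      using fun_vs.dim_span_eq_card_independent[OF fun_vs.independent_empty] by simp
    then show ?thesis using dim_C1_splines[of d] that by (simp add: card_degrees_0 card_degrees_2)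
  qed
  have singular: "fun_vs.dim (C1_splines \<Delta> d) = 4 * num_monomials (d - 2) + 4"
    if "has_singular_vertex \<Delta>" "n = 4" "2 \<le> d"
    using dim[OF span_generators_two_directions[OF singular_imp_two_directions[OF that(1)]]]
      card_degrees_minus(2)[OF that(3)] that by simp
  have nonsingular: "fun_vs.dim (C1_splines \<Delta> d) = n * num_monomials (d - 2) + 3"
    if ns: "\<not> has_singular_vertex \<Delta>" "3 \<le> n" "2 \<le> d"
  proof -
    obtain l where "cross2 (w 0) (w l) \<noteq> 0" "cross2 (w 1) (w l) \<noteq> 0"
      using two_directions_imp_singular ns(1,2) period by auto
    from dim[OF span_generators_three_directions[OF this]] show ?thesis
      using card_degrees_minus(1)[OF ns(3)] ns by simp
  qed
  have 1: "num_monomials 0 = 1" by (simp add: num_monomials_def)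
  \<comment> \<open>For d at least 4 this is the constant second difference m_d - 2 m_(d-2) +
    m_(d-4) = 4. For smaller d the last term is absent; truncated subtraction would turn it into m_0
    = 1.\<close>
  have sing: "4 * num_monomials (d - 2) + 4 = (if d \<le> 3 then num_monomials d + 2 * num_monomials (d - 2)
      else num_monomials d + 2 * num_monomials (d - 2) + num_monomials (d - 4))" if "2 \<le> d"
  proof -
    have "d = 2 \<or> d = 3 \<or> (\<exists>g. d = g + 4)" using that by presburger
    then consider "d = 2" | "d = 3" | g where "d = g + 4" by blast
    then show ?thesis by cases (simp_all add: 1 num_monomials_Suc eval_nat_numeral)
  qed
  \<comment> \<open>After cancelling n - 3 copies of m_(d-2), the identity for d at least 3 is 3
    m_(d-2) + 3 = m_d + 2 m_(d-3).\<close>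
  have nonsing: "n * num_monomials (d - 2) + 3 =
      (if d = 2 then num_monomials d + (n - 3) * num_monomials (d - 2)
       else num_monomials d + (n - 3) * num_monomials (d - 2) + 2 * num_monomials (d - 3))"
    if dn: "2 \<le> d" "3 \<le> n"
  proof -
    obtain m where m: "n = m + 3" using dn(2) by (metis add.commute le_Suc_ex)
    have "d = 2 \<or> (\<exists>g. d = g + 3)" using dn(1) by presburger
    then consider "d = 2" | g where "d = g + 3" by blast
    then show ?thesis unfolding m by cases (simp_all add: 1 num_monomials_Suc eval_nat_numeral distrib_right)
  qed
  show ?thesis using low singular nonsingular sing nonsing by auto
qed

end
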